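(* As $n\to\infty$, $$\log pp(n)\sim 2\pi\sqrt{\frac{n}{3\log n}}.$$
   Context: $pp(n)$ denotes the number of partitions of $n$ into primes, i.e. the number of finite sequences of primes $a_1\le a_2\le\dots\le a_k$ (of any length $k$, repetitions allowed) such that $\sum_{i=1}^k a_i=n$. $\log$ is the natural logarithm, and $g(n)\sim h(n)$ means $g(n)/h(n)\to1$. *)

theory Defs
  imports Complex_Main "HOL-Computational_Algebra.Primes" "HOL-Library.Landau_Symbols"
begin

definition prime_partitions :: "nat \<Rightarrow> nat list set" where
  "prime_partitions n = {as. sorted as \<and> (\<forall>a\<in>set as. prime a) \<and> sum_list as = n}"

definition pp :: "nat \<Rightarrow> nat" where
  "pp n = card (prime_partitions n)"

(* card is 0 on infinite sets, so this is what makes pp an actual count. *)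
lemma finite_prime_partitions: "finite (prime_partitions n)"
proof (rule finite_subset)
  show "prime_partitions n \<subseteq> {as. set as \<subseteq> {..n} \<and> length as \<le> n}"
  proof
    fix as assume "as \<in> prime_partitions n"
    then have pr: "\<forall>a\<in>set as. prime a" and s: "sum_list as = n"
      by (auto simp: prime_partitions_def)
    from s have "set as \<subseteq> {..n}"
      using member_le_sum_list by fastforce
    moreover from pr have "length as \<le> sum_list as"
    proof (induction as)
      case (Cons a as)
      then have "a \<ge> 1" and "length as \<le> sum_list as"
        by (auto dest: prime_ge_1_nat)
      then show ?case by simp
    qed simp
    ultimately show "as \<in> {as. set as \<subseteq> {..n} \<and> length as \<le> n}"
      using s by simp
  qed
  show "finite {as. set as \<subseteq> {..n} \<and> length as \<le> n}"
    by (rule finite_lists_length_le) simp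
qed

end

(* The generating function of pp at exp (- t) is exp F(t) with F(t) = - sum over primes p of ln (1 - exp (- p t)).
   The prime number theorem, obtained here from Newman's contour argument applied to the sum of
   (psi n - n) * (integral of x^(- s - 1) over [n, n + 1]), gives F(t) ~ (pi^2 / 6) / (t ln (1 / t)) as t -> 0.
   A single term of the series yields ln pp n <= n t + F(t), and the choice t = pi / sqrt (3 n ln n) is
   asymptotically optimal, with both summands close to half of the main term.  Conversely, at a slightly
   larger t the series is concentrated on indices slightly below n, and adding parts 2 and 3 shows
   pp m <= pp n unless n - m = 1, so that some pp m being large forces pp n to be large. *)
theory Submission
  imports Defs "HOL-Complex_Analysis.Complex_Analysis" "HOL-Real_Asymp.Real_Asymp" "HOL-Number_Theory.Prime_Powers"
begin

section \<open>Newman's Tauberian theorem\<close>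

text \<open>The terms in Newman's argument are entire and have telescoping norm bounds, so partial
  sums can be estimated on the left half circle and remainders on the right one. The analytic input
  is a continuation of the limit slightly across the imaginary axis, which amounts to (s - 1)
  zeta(s) having no zero on Re s = 1. Passing from primes to F takes two comparisons. With weights
  ln p, summation by parts compares the primes with all integers, where the constant arises as the
  sum of 1 / k^2. The weights are then removed because only primes within logarithmic factors of 1 /
  t matter, and there ln p is close to ln (1 / t). For the lower bound, pp is not monotone, so a
  large sum does not directly give a large coefficient. In units of half the main term, F at a times
  the optimal point is close to 1 / a. Evaluating F at slightly smaller and slightly larger a shows
  that indices outside a short range below n contribute little.\<close>

lemma newman_kernel_bound:
  fixes z q :: complex and R L C :: real
  assumes z: "norm z = R" and R: "R > 0" and s: "Re z \<noteq> 0"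
    and q: "norm q \<le> C * (exp (- Re z * L) / \<bar>Re z\<bar>)"
  shows "norm (q * exp (z * of_real L) * (1 + (z / of_real R)\<^sup>2) / z) \<le> 2 * C / R\<^sup>2"
proof -
  have z0: "z \<noteq> 0" using s by auto
  have zz: "z * cnj z = of_real (R\<^sup>2)"
    using z by (metis complex_norm_square of_real_power)
  \<comment> \<open>On \<open>norm z = R\<close> the kernel is the real number
    \<open>2 * Re z / R^2\<close>: it vanishes exactly where the bound on \<open>q\<close> blows up,
    while \<open>exp (z * L)\<close> cancels the exponential in that bound.\<close>
  have "(1 + (z / of_real R)\<^sup>2) / z = (z * cnj z + z\<^sup>2) / (of_real (R\<^sup>2) * z)"
    using R z0 by (simp add: zz field_simps power2_eq_square)
  also have "\<dots> = (cnj z + z) / of_real (R\<^sup>2)"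
    using z0 R by (simp add: field_simps power2_eq_square)
  also have "cnj z + z = of_real (2 * Re z)" by (simp add: complex_eq_iff)
  finally have k: "(1 + (z / of_real R)\<^sup>2) / z = of_real (2 * Re z / R\<^sup>2)" by simp
  have "norm (q * exp (z * of_real L) * (1 + (z / of_real R)\<^sup>2) / z)
      = norm q * exp (Re z * L) * (2 * \<bar>Re z\<bar> / R\<^sup>2)"
  proof -
    have "q * exp (z * of_real L) * (1 + (z / of_real R)\<^sup>2) / z
        = q * exp (z * of_real L) * of_real (2 * Re z / R\<^sup>2)"
      by (simp only: k[symmetric] times_divide_eq_right)
    then show ?thesis by (simp only: norm_mult norm_of_real) (simp add: abs_mult)
  qed
  also have "\<dots> \<le> C * (exp (- Re z * L) / \<bar>Re z\<bar>) * exp (Re z * L) * (2 * \<bar>Re z\<bar> / R\<^sup>2)"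
    using q by (intro mult_right_mono) auto
  also have "\<dots> = 2 * C / R\<^sup>2"
    using s R by (simp add: field_simps exp_minus)
  finally show ?thesis .
qed

text \<open>Each half circle carries half of the residue, and the remaining quotient
  \<open>B\<close> is entire, so its two integrals cancel. The halves are kept apart because they
  are estimated by different means.\<close>

lemma holomorphic_div_half_circles:
  fixes r :: real
  assumes A: "A holomorphic_on UNIV" and r: "r > 0"
  shows "contour_integral (part_circlepath 0 r (- pi / 2) (pi / 2)) (\<lambda>z. A z / z) +
         contour_integral (part_circlepath 0 r (pi / 2) (3 * pi / 2)) (\<lambda>z. A z / z) =
         2 * pi * \<i> * A 0"
proof -
  define B where "B = (\<lambda>z. if z = 0 then deriv A 0 else (A z - A 0) / (z - 0))"
  have B: "B holomorphic_on UNIV"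
    unfolding B_def by (rule pole_lemma_open) (use A in auto)
  have part: "((\<lambda>z. A z / z) has_contour_integral
      (A 0 * (\<i> * of_real (b - a)) + contour_integral (part_circlepath 0 r a b) B)) (part_circlepath 0 r a b)"
    if ab: "a < b" for a b
  proof -
    have "((\<lambda>t. \<i>) has_integral (b - a) *\<^sub>R \<i>) {a..b}"
      using has_integral_const_real[of \<i> a b] ab by simp
    then have "((\<lambda>z. 1 / z) has_contour_integral \<i> * of_real (b - a)) (part_circlepath 0 r a b)"
      using r by (subst has_contour_integral_part_circlepath_iff[OF ab])
        (simp add: scaleR_conv_of_real mult.commute)
    then have 1: "((\<lambda>z. A 0 * (1 / z)) has_contour_integral A 0 * (\<i> * of_real (b - a))) (part_circlepath 0 r a b)"
      by (rule has_contour_integral_lmul)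
    have "B contour_integrable_on part_circlepath 0 r a b"
      by (intro contour_integrable_continuous_part_circlepath holomorphic_on_imp_continuous_on
            holomorphic_on_subset[OF B]) auto
    then have "(B has_contour_integral contour_integral (part_circlepath 0 r a b) B) (part_circlepath 0 r a b)"
      by (rule has_contour_integral_integral)
    from has_contour_integral_add[OF 1 this] show ?thesis
    proof (rule has_contour_integral_eq)
      fix x assume "x \<in> path_image (part_circlepath 0 r a b)"
      then have "norm x = r" using r in_path_image_part_circlepath ab by fastforce
      then have "x \<noteq> 0" using r by auto
      then show "A 0 * (1 / x) + B x = A x / x"
        by (simp add: B_def diff_divide_distrib)
    qed
  qed
  have ends: "exp (\<i> * (3 * complex_of_real pi) / 2) = - \<i>"
    "exp (\<i> * complex_of_real pi / 2) = \<i>" "exp (- (\<i> * complex_of_real pi / 2)) = - \<i>"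
    using cos_3over2_pi sin_3over2_pi cis_conv_exp[of "3 * pi / 2"] cis_conv_exp[of "pi / 2"] cis_conv_exp[of "- (pi / 2)"]
    by (auto simp: complex_eq_iff mult.commute)
  have B_int: "B contour_integrable_on part_circlepath 0 r a b" for a b
    by (intro contour_integrable_continuous_part_circlepath holomorphic_on_imp_continuous_on
          holomorphic_on_subset[OF B]) auto
  let ?g = "part_circlepath 0 r (- pi / 2) (pi / 2) +++ part_circlepath 0 r (pi / 2) (3 * pi / 2)"
  have "(B has_contour_integral 0) ?g"
    by (rule Cauchy_theorem_convex_simple[OF B]) (auto simp: ends intro!: valid_path_join)
  moreover have "(B has_contour_integral
     (contour_integral (part_circlepath 0 r (- pi / 2) (pi / 2)) B +
      contour_integral (part_circlepath 0 r (pi / 2) (3 * pi / 2)) B)) ?g"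
    by (intro has_contour_integral_join has_contour_integral_integral B_int) auto
  ultimately have "contour_integral (part_circlepath 0 r (- pi / 2) (pi / 2)) B +
      contour_integral (part_circlepath 0 r (pi / 2) (3 * pi / 2)) B = 0"
    using has_contour_integral_unique by blast
  moreover have "contour_integral (part_circlepath 0 r (- pi / 2) (pi / 2)) (\<lambda>z. A z / z)
      = A 0 * (\<i> * of_real pi) + contour_integral (part_circlepath 0 r (- pi / 2) (pi / 2)) B"
    using contour_integral_unique[OF part[of "- pi / 2" "pi / 2"]] by simp
  moreover have "contour_integral (part_circlepath 0 r (pi / 2) (3 * pi / 2)) (\<lambda>z. A z / z)
      = A 0 * (\<i> * of_real pi) + contour_integral (part_circlepath 0 r (pi / 2) (3 * pi / 2)) B"
    using contour_integral_unique[OF part[of "pi / 2" "3 * pi / 2"]] by (simp add: field_simps)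
  ultimately show ?thesis by (simp add: algebra_simps)
qed

text \<open>The integral over the imaginary axis decays by one integration by parts.\<close>
lemma imaginary_segment_integral_bound:
  fixes H :: "complex \<Rightarrow> complex" and R :: real
  assumes H: "H holomorphic_on U" and U: "open U" "{z. Re z = 0} \<subseteq> U"
  obtains K where "\<And>L. L > 0 \<Longrightarrow>
     norm (contour_integral (linepath (\<i> * of_real R) (- \<i> * of_real R)) (\<lambda>z. H z * exp (z * of_real L))) \<le> K / L"
proof -
  let ?S = "closed_segment (\<i> * of_real R) (- \<i> * of_real R)"
  let ?g = "linepath (\<i> * of_real R) (- \<i> * of_real R)"
  have S: "Re z = 0" if "z \<in> ?S" for z
    using that by (auto simp: closed_segment_def)
  have SU: "?S \<subseteq> U" using S U by blast
  have dH: "deriv H holomorphic_on U" using H U by (simp add: holomorphic_deriv)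
  have "compact (H ` ?S)" "compact (deriv H ` ?S)"
    by (intro compact_continuous_image compact_segment holomorphic_on_imp_continuous_on
        holomorphic_on_subset[OF H SU] holomorphic_on_subset[OF dH SU])+
  then have "bounded (H ` ?S)" "bounded (deriv H ` ?S)"
    by (simp_all add: compact_imp_bounded)
  then obtain B1 B2 where B1: "\<And>z. z \<in> ?S \<Longrightarrow> norm (H z) \<le> B1" and B2: "\<And>z. z \<in> ?S \<Longrightarrow> norm (deriv H z) \<le> B2"
    unfolding bounded_iff by blast
  have B0: "B2 \<ge> 0" using order_trans[OF norm_ge_zero B2[OF ends_in_segment(1)]] .
  show thesis
  proof (rule that[of "2 * B1 + B2 * norm (- \<i> * of_real R - \<i> * of_real R)"])
    fix L :: real assume L: "L > 0"
    define P where "P = (\<lambda>z. H z * exp (z * of_real L) / of_real L)"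
    define P' where "P' = (\<lambda>z. H z * exp (z * of_real L) + deriv H z * exp (z * of_real L) / of_real L)"
    have P: "(P has_field_derivative P' z) (at z within U)" if "z \<in> U" for z
    proof -
      have "(H has_field_derivative deriv H z) (at z within U)"
        using H U that holomorphic_derivI has_field_derivative_at_within by blast
      then show ?thesis unfolding P_def P'_def
        using L by (auto intro!: derivative_eq_intros simp: field_simps)
    qed
    have n: "norm (exp (z * of_real L)) = 1" if "z \<in> ?S" for z
      using S[OF that] by simp
    have Pb: "norm (P z) \<le> B1 / L" if "z \<in> ?S" for z
      using B1[OF that] n[OF that] L by (simp add: P_def norm_mult norm_divide divide_right_mono)
    have c: "continuous_on ?S H" "continuous_on ?S (deriv H)"
      by (intro holomorphic_on_imp_continuous_on holomorphic_on_subset[OF H SU] holomorphic_on_subset[OF dH SU])+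
    have i1: "(P' has_contour_integral (P (- \<i> * of_real R) - P (\<i> * of_real R))) ?g"
      using contour_integral_primitive[OF P, of ?g] SU by simp
    have i2: "(\<lambda>z. deriv H z * exp (z * of_real L) / of_real L) contour_integrable_on ?g"
      by (intro contour_integrable_continuous_linepath continuous_intros c) (use L in auto)
    from has_contour_integral_diff[OF i1 has_contour_integral_integral[OF i2]]
    have "((\<lambda>z. H z * exp (z * of_real L)) has_contour_integral (P (- \<i> * of_real R) - P (\<i> * of_real R) -
       contour_integral ?g (\<lambda>z. deriv H z * exp (z * of_real L) / of_real L))) ?g"
      by (simp add: P'_def)
    then have eq: "contour_integral ?g (\<lambda>z. H z * exp (z * of_real L)) = P (- \<i> * of_real R) - P (\<i> * of_real R) -
       contour_integral ?g (\<lambda>z. deriv H z * exp (z * of_real L) / of_real L)"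
      by (rule contour_integral_unique)
    have "norm (contour_integral ?g (\<lambda>z. H z * exp (z * of_real L))) \<le> norm (P (- \<i> * of_real R)) + norm (P (\<i> * of_real R)) +
       norm (contour_integral ?g (\<lambda>z. deriv H z * exp (z * of_real L) / of_real L))"
      unfolding eq by (rule order_trans[OF norm_triangle_ineq4 add_right_mono[OF norm_triangle_ineq4]])
    also have "\<dots> \<le> B1 / L + B1 / L + B2 / L * norm (- \<i> * of_real R - \<i> * of_real R)"
    proof -
      have "norm (P (- \<i> * of_real R)) \<le> B1 / L" by (rule Pb[OF ends_in_segment(2)])
      moreover have "norm (P (\<i> * of_real R)) \<le> B1 / L" by (rule Pb[OF ends_in_segment(1)])
      moreover have "norm (contour_integral ?g (\<lambda>z. deriv H z * exp (z * of_real L) / of_real L))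
          \<le> B2 / L * norm (- \<i> * of_real R - \<i> * of_real R)"
      proof (rule contour_integral_bound_linepath[OF i2])
        show "B2 / L \<ge> 0" using L B0 by simp
        fix z assume z: "z \<in> ?S"
        show "norm (deriv H z * exp (z * of_real L) / of_real L) \<le> B2 / L"
          using B2[OF z] n[OF z] L by (simp add: norm_mult norm_divide divide_right_mono)
      qed
      ultimately show ?thesis by linarith
    qed
    also have "\<dots> = (2 * B1 + B2 * norm (- \<i> * of_real R - \<i> * of_real R)) / L"
      using L by (simp add: field_simps)
    finally show "norm (contour_integral ?g (\<lambda>z. H z * exp (z * of_real L))) \<le> \<dots>" .
  qed
qed

lemma telescoped_powr_sums:
  fixes s :: real
  assumes "s > 0"
  shows "(\<lambda>n. (real (Suc (n + N)) powr - s - real (n + N + 2) powr - s)) sums (real (Suc N) powr - s)"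
proof -
  have "(\<lambda>n. real (Suc (n + N)) powr - s) \<longlonglongrightarrow> 0"
    using assms by real_asymp
  from telescope_sums'[OF this] show ?thesis by simp
qed

lemma half_circle_Re:
  assumes x: "x \<in> path_image (part_circlepath 0 R a b)" and R: "R > 0" and ab: "a \<le> b"
  shows "norm x = R"
    and "a = - pi / 2 \<Longrightarrow> b = pi / 2 \<Longrightarrow> Re x \<ge> 0"
    and "a = pi / 2 \<Longrightarrow> b = 3 * pi / 2 \<Longrightarrow> Re x \<le> 0"
proof -
  obtain t where t: "a \<le> t" "t \<le> b" "x = of_real R * exp (\<i> * of_real t)"
    using x ab by (auto simp: path_image_part_circlepath)
  show "norm x = R" using t R by (simp add: norm_mult)
  have re: "Re x = R * cos t" using t by (simp add: Re_exp)
  show "Re x \<ge> 0" if "a = - pi / 2" "b = pi / 2"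
    using re R t that cos_ge_zero[of t] by simp
  show "Re x \<le> 0" if "a = pi / 2" "b = 3 * pi / 2"
    using re R t that cos_ge_zero[of "t - pi"] by (simp add: mult_nonneg_nonpos)
qed

text \<open>Since \<open>F 0 = 0\<close>, the integrand for \<open>F\<close> has no pole at \<open>0\<close>, so its right half circle can be pushed
  to the imaginary axis and no contour in the left half plane is needed for \<open>F\<close>.\<close>
lemma newman_zero:
  fixes f :: "nat \<Rightarrow> complex \<Rightarrow> complex" and C :: real
  assumes f: "\<And>n. f n holomorphic_on UNIV"
    and bd: "\<And>n z. Re z \<noteq> 0 \<Longrightarrow> z \<noteq> -1 \<Longrightarrow>
      norm (f n z) \<le> C * ((real (Suc n) powr - Re z - real (n + 2) powr - Re z) / Re z)"
    and F: "F holomorphic_on U" "open U" "{z. Re z \<ge> 0} \<subseteq> U"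
    and fF: "\<And>z. Re z > 0 \<Longrightarrow> (\<lambda>n. f n z) sums F z"
    and F0: "F 0 = 0"
  shows "(\<lambda>n. f n 0) sums 0"
proof -
  define S where "S = (\<lambda>N z. \<Sum>n<N. f n z)"
  define L where "L = (\<lambda>N::nat. ln (real (Suc N)))"
  have L: "real (Suc N) powr - s = exp (- s * L N)" for N s
    by (simp add: powr_def L_def)
  have C0: "C \<ge> 0"
  proof -
    have "0 \<le> C * (1 - 2 powr - 1)" using order_trans[OF norm_ge_zero bd[of 1 0]] by simp
    then show ?thesis by (simp add: powr_minus zero_le_mult_iff)
  qed
  have right: "norm (S N z - F z) \<le> C * (exp (- Re z * L N) / \<bar>Re z\<bar>)" if z: "Re z > 0" for N z
  proof -
    let ?g = "\<lambda>n. C * ((real (Suc (n + N)) powr - Re z - real (n + N + 2) powr - Re z) / Re z)"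
    have g: "?g sums (C * (real (Suc N) powr - Re z / Re z))"
      using telescoped_powr_sums[OF z, of N] by (intro sums_mult sums_divide) 
    have "(\<lambda>n. f (n + N) z) sums (F z - S N z)"
      unfolding S_def by (rule sums_split_initial_segment[OF fF[OF z]])
    then have "F z - S N z = (\<Sum>n. f (n + N) z)" by (simp add: sums_iff)
    also have "norm \<dots> \<le> (\<Sum>n. ?g n)"
    proof (rule norm_suminf_le)
      show "norm (f (n + N) z) \<le> ?g n" for n
        using bd[of z "n + N"] z by fastforce
    qed (use g in \<open>simp add: sums_iff\<close>)
    also have "\<dots> = C * (exp (- Re z * L N) / Re z)"
      using sums_unique[OF g] unfolding L by simp
    finally show ?thesis using z by (simp add: norm_minus_commute)
  qed
  have left: "norm (S N z) \<le> C * (exp (- Re z * L N) / \<bar>Re z\<bar>)" if z: "Re z < 0" "z \<noteq> -1" for N z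
  proof -
    have "norm (S N z) \<le> (\<Sum>n<N. C * ((real (Suc n) powr - Re z - real (n + 2) powr - Re z) / Re z))"
      unfolding S_def by (rule sum_norm_le) (use z bd in auto)
    also have "\<dots> = C * ((\<Sum>n<N. real (Suc n) powr - Re z - real (Suc (Suc n)) powr - Re z) / Re z)"
      by (simp add: sum_distrib_left sum_divide_distrib)
    also have "(\<Sum>n<N. real (Suc n) powr - Re z - real (Suc (Suc n)) powr - Re z)
       = 1 - real (Suc N) powr - Re z"
      using sum_lessThan_telescope'[of "\<lambda>n. real (Suc n) powr - Re z" N] by simp
    also have "C * ((1 - real (Suc N) powr - Re z) / Re z) \<le> C * (exp (- Re z * L N) / \<bar>Re z\<bar>)"
      unfolding L using z by (intro mult_left_mono C0) (simp add: divide_simps)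
    finally show ?thesis .
  qed
  have S_hol: "S N holomorphic_on UNIV" for N
    unfolding S_def by (intro holomorphic_intros f)
  \<comment> \<open>\<open>R \<ge> 2\<close> keeps the circle away from \<open>-1\<close>, where
    \<open>bd\<close> gives no information.\<close>
  have est: "\<exists>K. \<forall>N\<ge>1. norm (S N 0) \<le> 2 * C / R + K / L N" if R: "R \<ge> 2" for R :: real
  proof -
    let ?p = "part_circlepath 0 R (- pi / 2) (pi / 2)"
    let ?m = "part_circlepath 0 R (pi / 2) (3 * pi / 2)"
    let ?s = "linepath (\<i> * of_real R) (- \<i> * of_real R)"
    define H where "H = (\<lambda>z. (if z = 0 then deriv F 0 else (F z - F 0) / (z - 0)) * (1 + (z / of_real R)\<^sup>2))"
    have H: "H holomorphic_on U"
      unfolding H_def using R by (intro holomorphic_intros pole_lemma_open F) auto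
    have imU: "{z. Re z = 0} \<subseteq> U" using F(3) by auto
    obtain K where K: "\<And>L. L > 0 \<Longrightarrow> norm (contour_integral ?s (\<lambda>z. H z * exp (z * of_real L))) \<le> K / L"
      using imaginary_segment_integral_bound[OF H F(2) imU] by blast
    \<comment> \<open>At these two end points \<open>Re z = 0\<close> and the kernel bound says
      nothing; the strong form of the integral bound ignores a finite set.\<close>
    have fin: "finite {\<i> * of_real R, - \<i> * of_real R}" by simp
    have ex: "Re x \<noteq> 0" if "norm x = R" "x \<notin> {\<i> * of_real R, - \<i> * of_real R}" for x
    proof
      assume "Re x = 0"
      then have "\<bar>Im x\<bar> = R" using that by (simp add: cmod_def)
      then show False using that \<open>Re x = 0\<close> by (auto simp: complex_eq_iff)
    qed
    have ends: "exp (\<i> * complex_of_real pi / 2) = \<i>" "exp (- (\<i> * complex_of_real pi / 2)) = - \<i>"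
      using cis_conv_exp[of "pi / 2"] cis_conv_exp[of "- (pi / 2)"] by (auto simp: complex_eq_iff)
    have "norm (S N 0) \<le> 2 * C / R + (K / (2 * pi)) / L N" if N: "N \<ge> 1" for N
    proof -
      have LN: "L N > 0" using N by (simp add: L_def)
      define A where "A = (\<lambda>z. S N z * exp (z * of_real (L N)) * (1 + (z / of_real R)\<^sup>2))"
      define E where "E = (\<lambda>z. H z * exp (z * of_real (L N)))"
      have A: "A holomorphic_on UNIV" unfolding A_def
        using R by (intro holomorphic_intros S_hol) auto
      have E: "E holomorphic_on U" unfolding E_def by (intro holomorphic_intros H)
      have Az: "(\<lambda>z. A z / z) contour_integrable_on part_circlepath 0 R a b" if "a < b" for a b
      proof (intro contour_integrable_continuous_part_circlepath continuous_intros
          holomorphic_on_imp_continuous_on[OF holomorphic_on_subset[OF A]] ballI)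
        fix z assume "z \<in> path_image (part_circlepath 0 R a b)"
        then show "z \<noteq> 0" using half_circle_Re(1)[of z R a b] that R by auto
      qed auto
      have pU: "path_image ?p \<subseteq> {z. Re z \<ge> 0}" using half_circle_Re(2)[OF _ _ _ refl refl] R by auto
      have sU: "path_image ?s \<subseteq> {z. Re z \<ge> 0}" by (auto simp: closed_segment_def)
      have Ep: "E contour_integrable_on ?p"
        by (intro contour_integrable_continuous_part_circlepath holomorphic_on_imp_continuous_on
            holomorphic_on_subset[OF E]) (use pU F(3) in blast)
      have Es: "E contour_integrable_on ?s"
        by (intro contour_integrable_continuous_linepath holomorphic_on_imp_continuous_on
            holomorphic_on_subset[OF E]) (use sU F(3) in auto)
      have "convex {z. Re z \<ge> 0}" using convex_halfspace_Re_ge .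
      then have "(E has_contour_integral 0) (?p +++ ?s)"
        using pU sU R by (intro Cauchy_theorem_convex_simple[OF holomorphic_on_subset[OF E F(3)]])
          (auto simp: ends intro!: valid_path_join dest!: subsetD[OF path_image_join_subset])
      moreover have "(E has_contour_integral (contour_integral ?p E + contour_integral ?s E)) (?p +++ ?s)"
        by (intro has_contour_integral_join has_contour_integral_integral Ep Es) auto
      ultimately have E0: "contour_integral ?p E = - contour_integral ?s E"
        using has_contour_integral_unique by (metis eq_neg_iff_add_eq_0)
      have "norm (contour_integral ?m (\<lambda>z. A z / z)) \<le> 2 * C / R\<^sup>2 * R * (3 * pi / 2 - pi / 2)"
      proof (rule contour_integral_bound_part_circlepath_strong[OF Az fin])
        fix x assume x: "x \<in> path_image ?m - {\<i> * of_real R, - \<i> * of_real R}"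
        then have xm: "x \<in> path_image ?m" by blast
        have nx: "norm x = R" and "Re x \<le> 0"
          by (rule half_circle_Re(1)[OF xm], use R in \<open>simp_all add: field_simps\<close>)
             (rule half_circle_Re(3)[OF xm _ _ refl refl], use R in auto)
        with ex[of x] x have rx: "Re x < 0" by auto
        show "norm (A x / x) \<le> 2 * C / R\<^sup>2"
          unfolding A_def
          by (rule newman_kernel_bound[OF nx _ _ left]) (use rx nx R in auto)
      qed (use C0 R in auto)
      also have "\<dots> = 2 * pi * C / R" using R by (simp add: field_simps power2_eq_square)
      finally have Im: "norm (contour_integral ?m (\<lambda>z. A z / z)) \<le> 2 * pi * C / R" .
      have "norm (contour_integral ?p (\<lambda>z. A z / z - E z)) \<le> 2 * C / R\<^sup>2 * R * (pi / 2 - - pi / 2)"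
      proof (rule contour_integral_bound_part_circlepath_strong[OF _ fin])
        show "(\<lambda>z. A z / z - E z) contour_integrable_on ?p"
          by (intro contour_integrable_diff Az Ep) auto
        fix x assume x: "x \<in> path_image ?p - {\<i> * of_real R, - \<i> * of_real R}"
        then have xp: "x \<in> path_image ?p" by blast
        have nx: "norm x = R" and "Re x \<ge> 0"
          by (rule half_circle_Re(1)[OF xp], use R in \<open>simp_all add: field_simps\<close>)
             (rule half_circle_Re(2)[OF xp _ _ refl refl], use R in auto)
        with ex[of x] x have rx: "Re x > 0" by auto
        then have "x \<noteq> 0" by auto
        then have "A x / x - E x = (S N x - F x) * exp (x * of_real (L N)) * (1 + (x / of_real R)\<^sup>2) / x"
          by (simp add: A_def E_def H_def F0 field_simps)
        also have "norm \<dots> \<le> 2 * C / R\<^sup>2"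
          by (rule newman_kernel_bound[OF nx _ _ right]) (use rx nx R in auto)
        finally show "norm (A x / x - E x) \<le> 2 * C / R\<^sup>2" .
      qed (use C0 R in auto)
      also have "\<dots> = 2 * pi * C / R" using R by (simp add: field_simps power2_eq_square)
      finally have Ip: "norm (contour_integral ?p (\<lambda>z. A z / z - E z)) \<le> 2 * pi * C / R" .
      have Ipd: "contour_integral ?p (\<lambda>z. A z / z - E z) = contour_integral ?p (\<lambda>z. A z / z) - contour_integral ?p E"
        by (rule contour_integral_diff[OF Az Ep]) auto
      \<comment> \<open>On the right half circle \<open>S N\<close> is replaced by
        \<open>S N - F\<close>, which is small there; the price is the integral of \<open>E\<close>,
        moved to the imaginary segment that closes the half circle.\<close>
      have "2 * pi * \<i> * S N 0 = contour_integral ?p (\<lambda>z. A z / z) + contour_integral ?m (\<lambda>z. A z / z)"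
        using holomorphic_div_half_circles[OF A, of R] R by (simp add: A_def)
      also have "\<dots> = contour_integral ?p (\<lambda>z. A z / z - E z) + contour_integral ?m (\<lambda>z. A z / z) - contour_integral ?s E"
        using Ipd E0 by simp
      finally have eq: "2 * pi * \<i> * S N 0 = \<dots>" .
      have "2 * pi * norm (S N 0) = norm (2 * pi * \<i> * S N 0)" by (simp add: norm_mult)
      also have "\<dots> \<le> norm (contour_integral ?p (\<lambda>z. A z / z - E z)) + norm (contour_integral ?m (\<lambda>z. A z / z)) + norm (contour_integral ?s E)"
        unfolding eq by (rule order_trans[OF norm_triangle_ineq4 add_right_mono[OF norm_triangle_ineq]])
      also have "\<dots> \<le> 2 * pi * C / R + 2 * pi * C / R + K / L N"
        using add_mono[OF add_mono[OF Ip Im] K[OF LN]] unfolding E_def .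
      finally show ?thesis using R LN by (simp add: field_simps)
    qed
    then show ?thesis by blast
  qed
  have "(\<lambda>N. S N 0) \<longlonglongrightarrow> 0"
  proof (rule tendstoI)
    fix e :: real assume e: "e > 0"
    define R where "R = max 2 (4 * C / e)"
    have R: "R \<ge> 2" "R \<ge> 4 * C / e" by (auto simp: R_def)
    have CR: "2 * C / R \<le> e / 2" using R e by (simp add: field_simps)
    obtain K where K: "\<And>N. N \<ge> 1 \<Longrightarrow> norm (S N 0) \<le> 2 * C / R + K / L N"
      using est[OF R(1)] by blast
    have "(\<lambda>N. K / L N) \<longlonglongrightarrow> 0" unfolding L_def by real_asymp
    then have "eventually (\<lambda>N. K / L N < e / 2) sequentially"
      using e by (intro order_tendstoD) auto
    then show "eventually (\<lambda>N. dist (S N 0) 0 < e) sequentially"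
      using eventually_ge_at_top[of 1]
    proof eventually_elim
      case (elim N)
      have "norm (S N 0) < e" using K[OF elim(2)] CR elim(1) by linarith
      then show ?case by (simp add: dist_norm)
    qed
  qed
  then show ?thesis by (simp add: sums_def S_def)
qed

section \<open>The zeta function on the line Re s = 1\<close>

lemma norm_nat_powr: "norm (of_nat n powr s :: complex) = real n powr Re s"
  by (subst norm_powr_real_powr) auto

lemma summable_nat_powr_shift: "a > 1 \<Longrightarrow> summable (\<lambda>n. real (Suc n) powr - a)"
  using summable_real_powr_iff[of "- a"] by (subst summable_Suc_iff) auto

lemma powr_difference_bound:
  fixes a x :: real and s :: complex
  assumes a: "a > 0" and ax: "a \<le> x" and s: "Re s > 0"
  shows "norm (of_real x powr - s - of_real a powr - s) \<le> norm s * a powr (- Re s - 1) * (x - a)"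
proof -
  have "norm ((of_real x :: complex) powr - s - of_real a powr - s)
      \<le> norm s * a powr (- Re s - 1) * norm (of_real x - of_real a :: complex)"
  proof (rule field_differentiable_bound[where S = "closed_segment (of_real a) (of_real x)"
        and f' = "\<lambda>z. - s * z powr (- s - 1)"])
    fix z :: complex assume "z \<in> closed_segment (of_real a) (of_real x)"
    then obtain y where y: "z = of_real y" "a \<le> y"
      using ax by (auto simp: closed_segment_of_real closed_segment_eq_real_ivl)
    show "((\<lambda>z. z powr - s) has_field_derivative - s * z powr (- s - 1)) (at z within closed_segment (of_real a) (of_real x))"
      by (rule has_field_derivative_at_within, rule has_field_derivative_powr) (use y a in auto)
    have "y powr (- Re s - 1) \<le> a powr (- Re s - 1)"
      using a y s by (intro powr_mono2') auto
    then show "norm (- s * z powr (- s - 1)) \<le> norm s * a powr (- Re s - 1)"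
      using y a by (simp add: norm_mult norm_powr_real_powr mult_left_mono)
  qed auto
  also have "norm (of_real x - of_real a :: complex) = x - a"
    using ax by (metis abs_of_nonneg diff_ge_0_iff_ge norm_of_real of_real_diff)
  finally show ?thesis .
qed

section \<open>The function (s - 1) zeta(s) on Re s > 0\<close>

definition zeta_term :: "nat \<Rightarrow> complex \<Rightarrow> complex" where
  "zeta_term n s = (s - 1) * of_nat (Suc n) powr - s + (of_nat (Suc (Suc n)) powr (1 - s) - of_nat (Suc n) powr (1 - s))"

text \<open>Each summand is \<open>(s - 1)\<close> times the error of replacing \<open>\<integral> x\<^sup>-\<^sup>s dx\<close> over
  \<open>[n + 1, n + 2]\<close> by its left end point value, hence summable for \<open>Re s > 0\<close>.\<close>
definition zeta_pole :: "complex \<Rightarrow> complex" where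
  "zeta_pole s = 1 + (\<Sum>n. zeta_term n s)"

lemma norm_zeta_term_le:
  assumes s: "Re s > 0"
  shows "norm (zeta_term n s) \<le> norm (s - 1) * norm s * real (Suc n) powr (- Re s - 1)"
proof -
  define a where "a = real (Suc n)"
  have a: "a > 0" by (simp add: a_def)
  \<comment> \<open>The tangent of \<open>z powr (1 - s)\<close> at \<open>a\<close> is subtracted,
    so that the increment of \<open>h\<close> over a unit step is \<open>zeta_term\<close> and its
    derivative is a difference of two powers.\<close>
  define h where "h = (\<lambda>z::complex. z powr (1 - s) - (1 - s) * (z - of_real a) * of_real a powr - s)"
  have "norm (h (of_real (a + 1)) - h (of_real a))
      \<le> norm (1 - s) * (norm s * a powr (- Re s - 1)) * norm (of_real (a + 1) - of_real a :: complex)"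
  proof (rule field_differentiable_bound[where S = "closed_segment (of_real a) (of_real (a + 1))"
        and f' = "\<lambda>z. (1 - s) * (z powr - s - of_real a powr - s)"])
    fix z :: complex assume "z \<in> closed_segment (of_real a) (of_real (a + 1))"
    then have "z \<in> of_real ` closed_segment a (a + 1)" by (simp only: closed_segment_of_real)
    then obtain y where y: "z = of_real y" "a \<le> y" "y \<le> a + 1"
      by (auto simp: closed_segment_eq_real_ivl)
    have "z \<notin> \<real>\<^sub>\<le>\<^sub>0" using y a by (auto simp: complex_nonpos_Reals_iff)
    then have "(h has_field_derivative (1 - s) * (z powr - s - of_real a powr - s)) (at z)"
      unfolding h_def by (auto intro!: derivative_eq_intros simp: algebra_simps)
    then show "(h has_field_derivative (1 - s) * (z powr - s - of_real a powr - s)) (at z within closed_segment (of_real a) (of_real (a + 1)))"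
      by (rule has_field_derivative_at_within)
    have "norm (of_real y powr - s - of_real a powr - s) \<le> norm s * a powr (- Re s - 1) * (y - a)"
      by (rule powr_difference_bound) (use a y s in auto)
    also have "\<dots> \<le> norm s * a powr (- Re s - 1) * 1"
      using y by (intro mult_left_mono) auto
    finally show "norm ((1 - s) * (z powr - s - of_real a powr - s)) \<le> norm (1 - s) * (norm s * a powr (- Re s - 1))"
      using y by (simp add: norm_mult mult_left_mono)
  qed auto
  moreover have "h (of_real (a + 1)) - h (of_real a) = zeta_term n s"
    by (simp add: h_def zeta_term_def a_def algebra_simps)
  moreover have "norm (of_real (a + 1) - of_real a :: complex) = 1" by simp
  ultimately show ?thesis unfolding norm_minus_commute[of 1 s] by (simp only: a_def mult_1_right mult.assoc)
qed

text \<open>Domination in the form expected by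
  \<open>series_and_derivative_comparison_local\<close>: within distance \<open>Re x / 2\<close> of
  \<open>x\<close> real parts stay above \<open>Re x / 2\<close>, so one exponent beyond 1 serves
  the whole ball.\<close>

lemma summable_zeta_term_local:
  assumes x: "Re x > 0"
  shows "\<exists>d h. 0 < d \<and> summable h \<and>
    (\<forall>\<^sub>F n in sequentially. \<forall>y\<in>ball x d \<inter> {s. Re s > 0}. norm (zeta_term n y) \<le> h n)"
proof (intro exI conjI)
  let ?d = "Re x / 2"
  let ?M = "(norm x + ?d + 1) * (norm x + ?d)"
  show "summable (\<lambda>n. ?M * real (Suc n) powr - (?d + 1))"
    by (rule summable_mult, rule summable_nat_powr_shift) (use x in auto)
  show "\<forall>\<^sub>F n in sequentially. \<forall>y\<in>ball x ?d \<inter> {s. Re s > 0}. norm (zeta_term n y) \<le> ?M * real (Suc n) powr - (?d + 1)"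
  proof (intro always_eventually allI ballI)
    fix n y assume y: "y \<in> ball x ?d \<inter> {s. Re s > 0}"
    have yx: "norm (y - x) < ?d" using y by (simp add: dist_norm norm_minus_commute)
    have "Re x - Re y \<le> norm (y - x)" using abs_Re_le_cmod[of "y - x"] by simp
    then have ry: "Re y \<ge> ?d" using yx by simp
    have ny: "norm y \<le> norm x + ?d" using yx norm_triangle_ineq[of x "y - x"] by simp
    have ny1: "norm (y - 1) \<le> norm x + ?d + 1"
      using ny norm_triangle_ineq4[of y 1] by simp
    have "norm (zeta_term n y) \<le> norm (y - 1) * norm y * real (Suc n) powr (- Re y - 1)"
      by (rule norm_zeta_term_le) (use y in auto)
    also have "\<dots> \<le> ?M * real (Suc n) powr - (?d + 1)"
    proof (rule mult_mono)
      show "norm (y - 1) * norm y \<le> ?M"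
        by (rule mult_mono[OF ny1 ny]) (use x in auto)
      show "real (Suc n) powr (- Re y - 1) \<le> real (Suc n) powr - (?d + 1)"
        using ry by (intro powr_mono) auto
    qed (use x in auto)
    finally show "norm (zeta_term n y) \<le> ?M * real (Suc n) powr - (?d + 1)" .
  qed
qed (use x in auto)

lemma zeta_term_derivative:
  "\<exists>D. (zeta_term n has_field_derivative D) (at s)"
proof -
  have "zeta_term n holomorphic_on UNIV"
    unfolding zeta_term_def by (intro holomorphic_intros)
  then show ?thesis
    by (meson UNIV_I field_differentiable_def holomorphic_on_imp_differentiable_at open_UNIV)
qed

lemma zeta_term_sums: "Re s > 0 \<Longrightarrow> (\<lambda>n. zeta_term n s) sums (zeta_pole s - 1)"
  and holomorphic_zeta_pole: "zeta_pole holomorphic_on {s. Re s > 0}"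
proof -
  obtain D where D: "\<And>n s. (zeta_term n has_field_derivative D n s) (at s)"
    using zeta_term_derivative by metis
  have op: "open {s. Re s > 0}" by (rule open_halfspace_Re_gt)
  have "\<exists>g g'. \<forall>x\<in>{s. Re s > 0}. (\<lambda>n. zeta_term n x) sums g x \<and> (\<lambda>n. D n x) sums g' x \<and>
      (g has_field_derivative g' x) (at x)"
    by (rule series_and_derivative_comparison_local[OF op D]) (use summable_zeta_term_local in auto)
  then obtain g g' where g: "\<And>x. Re x > 0 \<Longrightarrow> (\<lambda>n. zeta_term n x) sums g x"
     "\<And>x. Re x > 0 \<Longrightarrow> (g has_field_derivative g' x) (at x)" by blast
  have eq: "zeta_pole x = 1 + g x" if "Re x > 0" for x
    using g(1)[OF that] by (simp add: zeta_pole_def sums_iff)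
  show "(\<lambda>n. zeta_term n s) sums (zeta_pole s - 1)" if "Re s > 0" for s using g(1)[OF that] eq[OF that] by simp
  have "g holomorphic_on {s. Re s > 0}"
    using g(2) op by (auto simp: holomorphic_on_open)
  then have "(\<lambda>s. 1 + g s) holomorphic_on {s. Re s > 0}" by (intro holomorphic_intros)
  then show "zeta_pole holomorphic_on {s. Re s > 0}"
    using eq by (metis (mono_tags, lifting) holomorphic_transform mem_Collect_eq)
qed

lemma zeta_pole_1: "zeta_pole 1 = 1"
  by (simp add: zeta_pole_def zeta_term_def del: of_nat_Suc)

definition zeta_series :: "complex \<Rightarrow> complex" where
  "zeta_series s = (\<Sum>n. of_nat n powr - s)"

lemma summable_norm_zeta: "Re s > 1 \<Longrightarrow> summable (\<lambda>n. norm (of_nat n powr - s :: complex))"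
  using summable_real_powr_iff[of "- Re s"] by (simp add: norm_nat_powr)

lemma zeta_series_sums: "Re s > 1 \<Longrightarrow> (\<lambda>n. of_nat n powr - s) sums zeta_series s"
  unfolding zeta_series_def by (rule summable_sums, rule summable_norm_cancel, rule summable_norm_zeta)

text \<open>For \<open>Re s > 1\<close> the two parts of \<open>zeta_term\<close> converge
  separately; the second telescopes to -1 and cancels the leading 1 of
  \<open>zeta_pole\<close>.\<close>

lemma zeta_pole_eq:
  assumes s: "Re s > 1"
  shows "zeta_pole s = (s - 1) * zeta_series s"
proof -
  have "(\<lambda>n. of_nat (Suc n) powr - s) sums (zeta_series s - of_nat 0 powr - s)"
    using zeta_series_sums[OF s] by (subst sums_Suc_iff) simp
  then have 1: "(\<lambda>n. (s - 1) * of_nat (Suc n) powr - s) sums ((s - 1) * zeta_series s)"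
    by (intro sums_mult) simp
  have "(\<lambda>n. norm (of_nat (Suc n) powr (1 - s) :: complex)) \<longlonglongrightarrow> 0"
    unfolding norm_nat_powr using s by real_asymp
  then have "(\<lambda>n. of_nat (Suc n) powr (1 - s) :: complex) \<longlonglongrightarrow> 0" by (rule tendsto_norm_zero_cancel)
  from telescope_sums[OF this]
  have 2: "(\<lambda>n. of_nat (Suc (Suc n)) powr (1 - s) - of_nat (Suc n) powr (1 - s) :: complex) sums (- 1)"
    by simp
  have "(\<lambda>n. zeta_term n s) sums ((s - 1) * zeta_series s + - 1)"
    unfolding zeta_term_def by (rule sums_add[OF 1 2])
  then show ?thesis using zeta_term_sums[of s] s sums_unique2 by fastforce
qed

section \<open>The Dirichlet series of -zeta'/zeta\<close>

lemma has_sum_mult_Times: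
  fixes f :: "'a \<Rightarrow> complex" and g :: "'b \<Rightarrow> complex"
  assumes f: "(\<lambda>x. norm (f x)) summable_on X" "(f has_sum A) X" and g: "(\<lambda>x. norm (g x)) summable_on Y" "(g has_sum B) Y"
  shows "((\<lambda>(x, y). f x * g y) has_sum (A * B)) (X \<times> Y)"
proof (rule has_sum_SigmaI)
  show "((\<lambda>y. (\<lambda>(x, y). f x * g y) (x, y)) has_sum f x * B) Y" for x
    using has_sum_cmult_right[OF g(2)] by simp
  show "((\<lambda>x. f x * B) has_sum (A * B)) X"
    using has_sum_cmult_left[OF f(2)] by simp
  have "(\<lambda>p. norm ((\<lambda>(x, y). f x * g y) p)) summable_on X \<times> Y"
    unfolding Infinite_Sum.abs_summable_on_Sigma_iff
  proof (intro conjI ballI)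
    show "(\<lambda>y. norm ((\<lambda>(x, y). f x * g y) (x, y))) summable_on Y" for x
      using summable_on_cmult_right[OF g(1), of "norm (f x)"] by (simp add: norm_mult)
    have "infsum (\<lambda>y. norm ((\<lambda>(x, y). f x * g y) (x, y))) Y = norm (f x) * infsum (\<lambda>y. norm (g y)) Y" for x
      by (simp add: norm_mult infsum_cmult_right')
    then show "(\<lambda>x. norm (infsum (\<lambda>y. norm ((\<lambda>(x, y). f x * g y) (x, y))) Y)) summable_on X"
      using summable_on_cmult_left[OF f(1), of "infsum (\<lambda>y. norm (g y)) Y"]
      by (simp add: infsum_nonneg norm_mult)
  qed
  then show "(\<lambda>(x, y). f x * g y) summable_on X \<times> Y"
    by (rule Infinite_Sum.abs_summable_summable)
qed

text \<open>Index 0 is removed because every number divides 0, which would spoil the regrouping by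
  divisors; \<open>f 0 = 0\<close> makes the removal harmless.\<close>

lemma has_sum_nat_sums:
  fixes f :: "nat \<Rightarrow> complex"
  assumes "summable (\<lambda>n. norm (f n))" "f sums S" "f 0 = 0"
  shows "(\<lambda>x. norm (f x)) summable_on {0<..}" "(f has_sum S) {0<..}"
proof -
  have "(f has_sum S) UNIV" using assms norm_summable_imp_has_sum by blast
  then show "(f has_sum S) {0<..}"
    by (rule has_sum_cong_neutral[THEN iffD1, rotated -1]) (use assms in auto)
  show "(\<lambda>x. norm (f x)) summable_on {0<..}"
    using norm_summable_imp_summable_on[of "\<lambda>n. norm (f n)"] assms(1)
    by (auto intro: summable_on_subset_banach)
qed

text \<open>For \<open>Re s > 1\<close> this is -zeta'/zeta, and \<open>log_series\<close> below is
  -zeta'.\<close>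

definition mangoldt_series :: "complex \<Rightarrow> complex" where
  "mangoldt_series s = (\<Sum>n. mangoldt n * of_nat n powr - s)"

definition log_series :: "complex \<Rightarrow> complex" where
  "log_series s = (\<Sum>n. of_real (ln (real n)) * of_nat n powr - s)"

lemma summable_ln_powr:
  assumes a: "a > 1"
  shows "summable (\<lambda>n. ln (real n) * real n powr - a)"
proof (rule summable_comparison_test_bigo)
  show "summable (\<lambda>n. norm (real n powr (- (1 + a) / 2)))"
    using a summable_real_powr_iff[of "- (1 + a) / 2"] by simp
  show "(\<lambda>n. ln (real n) * real n powr - a) \<in> O(\<lambda>n. real n powr (- (1 + a) / 2))"
    using a by real_asymp
qed

lemma mangoldt_le_ln: "n > 0 \<Longrightarrow> mangoldt n \<le> ln (real n)"
proof -
  assume n: "n > 0"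
  have "mangoldt n \<le> (\<Sum>d | d dvd n. mangoldt d :: real)"
    by (rule member_le_sum) (use n mangoldt_nonneg in auto)
  then show ?thesis using mangoldt_sum[of n, where ?'a = real] n by simp
qed

lemma
  assumes s: "Re s > 1"
  shows summable_norm_log: "summable (\<lambda>n. norm (of_real (ln (real n)) * of_nat n powr - s :: complex))"
    and summable_norm_mangoldt: "summable (\<lambda>n. norm (mangoldt n * of_nat n powr - s :: complex))"
proof -
  have "ln (real n) \<ge> 0" for n by (cases n) auto
  then show 1: "summable (\<lambda>n. norm (of_real (ln (real n)) * of_nat n powr - s :: complex))"
    using summable_ln_powr[OF s] by (simp add: norm_mult norm_nat_powr)
  show "summable (\<lambda>n. norm (mangoldt n * of_nat n powr - s :: complex))"
  proof (rule summable_comparison_test'[OF 1])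
    fix n :: nat
    show "norm (norm (mangoldt n * of_nat n powr - s :: complex)) \<le> norm (of_real (ln (real n)) * of_nat n powr - s :: complex)"
      using mangoldt_le_ln[of n] by (cases "n = 0") (auto simp: norm_mult abs_mult intro!: mult_right_mono)
  qed
qed

lemma mangoldt_series_sums: "Re s > 1 \<Longrightarrow> (\<lambda>n. mangoldt n * of_nat n powr - s) sums mangoldt_series s"
  unfolding mangoldt_series_def by (rule summable_sums, rule summable_norm_cancel, rule summable_norm_mangoldt)

lemma log_series_sums: "Re s > 1 \<Longrightarrow> (\<lambda>n. of_real (ln (real n)) * of_nat n powr - s) sums log_series s"
  unfolding log_series_def by (rule summable_sums, rule summable_norm_cancel, rule summable_norm_log)

text \<open>Dirichlet convolution: a pair (x, y) is sent to its product together with the divisor x,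
  and the von Mangoldt values of the divisors of n add up to \<open>ln n\<close>. Unordered sums
  make this regrouping legitimate.\<close>

lemma mangoldt_series_mult_zeta:
  assumes s: "Re s > 1"
  shows "mangoldt_series s * zeta_series s = log_series s"
proof -
  let ?m = "\<lambda>n. mangoldt n * of_nat n powr - s" and ?z = "\<lambda>n. of_nat n powr - s :: complex"
  let ?P = "{0<..} :: nat set"
  have P: "((\<lambda>(x, y). ?m x * ?z y) has_sum (mangoldt_series s * zeta_series s)) (?P \<times> ?P)"
    using has_sum_mult_Times[OF has_sum_nat_sums[OF summable_norm_mangoldt[OF s] mangoldt_series_sums[OF s]]
        has_sum_nat_sums[OF summable_norm_zeta[OF s] zeta_series_sums[OF s]]] by simp
  have "((\<lambda>(n, d). mangoldt d * of_nat n powr - s) has_sum (mangoldt_series s * zeta_series s)) (SIGMA n:?P. {d. d dvd n})"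
  proof (rule has_sum_reindex_bij_witness[where i = "\<lambda>(n, d). (d, n div d)" and j = "\<lambda>(x, y). (x * y, x)",
        THEN iffD1, OF _ _ _ _ _ refl P])
    show "(\<lambda>(n, d). (d, n div d)) ((\<lambda>(x, y). (x * y, x)) a) = a" if "a \<in> ?P \<times> ?P" for a
      using that by auto
    show "(\<lambda>(x, y). (x * y, x)) a \<in> (SIGMA n:?P. {d. d dvd n})" if "a \<in> ?P \<times> ?P" for a
      using that by auto
    show "(\<lambda>(x, y). (x * y, x)) ((\<lambda>(n, d). (d, n div d)) b) = b" if "b \<in> (SIGMA n:?P. {d. d dvd n})" for b
      using that by auto
    show "(\<lambda>(n, d). (d, n div d)) b \<in> ?P \<times> ?P" if "b \<in> (SIGMA n:?P. {d. d dvd n})" for b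
      using that by (auto elim!: dvdE)
    show "(\<lambda>(n, d). mangoldt d * of_nat n powr - s) ((\<lambda>(x, y). (x * y, x)) a) = (\<lambda>(x, y). ?m x * ?z y) a" for a
      by (auto simp: powr_times_real split: prod.splits)
  qed
  then have "((\<lambda>n. of_real (ln (real n)) * of_nat n powr - s) has_sum (mangoldt_series s * zeta_series s)) ?P"
  proof (rule has_sum_Sigma')
    fix n assume n: "n \<in> ?P"
    then have fin: "finite {d. d dvd n}" by simp
    have "(\<Sum>d | d dvd n. mangoldt d * of_nat n powr - s) = of_real (ln (real n)) * (of_nat n powr - s :: complex)"
      using mangoldt_sum[of n, where ?'a = complex] n by (simp flip: sum_distrib_right)
    with has_sum_finite[OF fin, of "\<lambda>d. mangoldt d * of_nat n powr - s :: complex"]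
    show "((\<lambda>y. (\<lambda>(n, d). mangoldt d * of_nat n powr - s) (n, y)) has_sum of_real (ln (real n)) * (of_nat n powr - s :: complex)) {d. d dvd n}"
      by simp
  qed
  moreover have "((\<lambda>n. of_real (ln (real n)) * of_nat n powr - s) has_sum log_series s) ?P"
    by (rule has_sum_nat_sums(2)[OF summable_norm_log[OF s] log_series_sums[OF s]]) simp
  ultimately show ?thesis using has_sum_unique by blast
qed

lemma zeta_series_derivative:
  assumes "Re s > 1"
  shows "(zeta_series has_field_derivative - log_series s) (at s)"
proof -
  let ?S = "{s. Re s > 1}"
  let ?f' = "\<lambda>n s. - (of_real (ln (real n)) * of_nat n powr - s) :: complex"
  have op: "open ?S" by (rule open_halfspace_Re_gt)
  have "\<exists>g g'. \<forall>x\<in>?S. (\<lambda>n. of_nat n powr - x) sums g x \<and> (\<lambda>n. ?f' n x) sums g' x \<and>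
      (g has_field_derivative g' x) (at x)"
  proof (rule series_and_derivative_comparison_local[OF op])
    fix n :: nat and x :: complex
    show "((\<lambda>s. of_nat n powr - s) has_field_derivative ?f' n x) (at x)"
    proof (cases "n = 0")
      case False
      then have "((\<lambda>s. of_nat n powr - s) has_field_derivative Ln (of_nat n) * of_nat n powr - x * - 1) (at x)"
        by (intro DERIV_chain2[OF has_field_derivative_powr_right] derivative_intros) auto
      then show ?thesis using False by (simp add: Ln_of_nat)
    qed simp
  next
    fix x assume "x \<in> ?S"
    then have x: "Re x > 1" by simp
    show "\<exists>d h. 0 < d \<and> summable h \<and> (\<forall>\<^sub>F n in sequentially. \<forall>y\<in>ball x d \<inter> ?S. norm (of_nat n powr - y :: complex) \<le> h n)"
    proof (intro exI conjI)
      let ?d = "(Re x - 1) / 2"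
      show "summable (\<lambda>n. real n powr - (1 + ?d))"
        using x by (subst summable_real_powr_iff) auto
      show "\<forall>\<^sub>F n in sequentially. \<forall>y\<in>ball x ?d \<inter> ?S. norm (of_nat n powr - y :: complex) \<le> real n powr - (1 + ?d)"
        using eventually_ge_at_top[of 1]
      proof (eventually_elim, intro ballI)
        fix n :: nat and y assume n: "n \<ge> 1" and y: "y \<in> ball x ?d \<inter> ?S"
        have "Re x - Re y \<le> norm (x - y)" using abs_Re_le_cmod[of "x - y"] by simp
        also have "\<dots> < ?d" using y by (simp add: dist_norm)
        finally have "Re y \<ge> 1 + ?d" by (simp add: field_simps)
        then show "norm (of_nat n powr - y :: complex) \<le> real n powr - (1 + ?d)"
          unfolding norm_nat_powr using n by (intro powr_mono) auto
      qed
    qed (use x in auto)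
  qed
  then obtain g g' where g: "\<And>x. Re x > 1 \<Longrightarrow> (\<lambda>n. of_nat n powr - x) sums g x"
     "\<And>x. Re x > 1 \<Longrightarrow> (\<lambda>n. ?f' n x) sums g' x"
     "\<And>x. Re x > 1 \<Longrightarrow> (g has_field_derivative g' x) (at x)" by blast
  have g': "g' s = - log_series s"
    using g(2)[OF assms] sums_minus[OF log_series_sums[OF assms]] sums_unique2 by blast
  show ?thesis
  proof (rule has_field_derivative_transform_within_open[OF _ op])
    show "(g has_field_derivative - log_series s) (at s)" using g(3)[OF assms] g' by simp
    show "g x = zeta_series x" if "x \<in> ?S" for x
      using g(1)[of x] zeta_series_sums[of x] that sums_unique2 by blast
  qed (use assms in simp)
qed

text \<open>The logarithmic derivative of (s - 1) zeta(s), multiplied out because the nonvanishing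
  of \<open>zeta_pole\<close> is still to be derived from it.\<close>

lemma mangoldt_series_mult_zeta_pole:
  assumes s: "Re s > 1"
  shows "mangoldt_series s * zeta_pole s = zeta_pole s / (s - 1) - deriv zeta_pole s"
proof -
  have op: "open {s. Re s > 1}" by (rule open_halfspace_Re_gt)
  have s1: "s \<noteq> 1" using s by auto
  have "((\<lambda>s. (s - 1) * zeta_series s) has_field_derivative (zeta_series s + (s - 1) * - log_series s)) (at s)"
    by (auto intro!: derivative_eq_intros zeta_series_derivative s)
  then have "(zeta_pole has_field_derivative (zeta_series s + (s - 1) * - log_series s)) (at s)"
    by (rule has_field_derivative_transform_within_open[OF _ op]) (use s zeta_pole_eq in auto)
  then have "deriv zeta_pole s = zeta_series s - (s - 1) * log_series s"
    by (simp add: DERIV_imp_deriv)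
  then show ?thesis
    using s1 by (simp add: zeta_pole_eq[OF s] mangoldt_series_mult_zeta[OF s, symmetric])
qed

section \<open>Nonvanishing on Re s = 1\<close>

lemma holomorphic_on_imp_isCont:
  "f holomorphic_on S \<Longrightarrow> open S \<Longrightarrow> x \<in> S \<Longrightarrow> isCont f x"
  using holomorphic_on_imp_continuous_on continuous_on_eq_continuous_at by blast

text \<open>The limit \<open>k\<close> is the order of the zero, read off from the factorisation
  \<open>(w - \<xi>) ^ n * g w\<close>. The point \<open>z\<close> excludes that \<open>f\<close>
  vanishes identically.\<close>

lemma tendsto_mult_log_deriv:
  fixes f :: "complex \<Rightarrow> complex"
  assumes f: "f holomorphic_on S" "open S" "connected S" and x: "\<xi> \<in> S" and z: "z \<in> S" "f z \<noteq> 0"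
  obtains k :: nat where "((\<lambda>s. (s - \<xi>) * (deriv f s / f s)) \<longlongrightarrow> of_nat k) (at \<xi>)" "f \<xi> = 0 \<Longrightarrow> k > 0"
    "\<forall>\<^sub>F s in at \<xi>. f s \<noteq> 0"
proof -
  have df: "deriv f holomorphic_on S" using f by (intro holomorphic_deriv)
  have c: "isCont f \<xi>" "isCont (deriv f) \<xi>"
    using f df x holomorphic_on_imp_isCont by blast+
  show thesis
  proof (cases "f \<xi> = 0")
    case False
    then have "((\<lambda>s. (s - \<xi>) * (deriv f s / f s)) \<longlongrightarrow> (\<xi> - \<xi>) * (deriv f \<xi> / f \<xi>)) (at \<xi>)"
      using c by (intro tendsto_intros) (auto simp: isCont_def)
    moreover have "\<forall>\<^sub>F s in at \<xi>. f s \<noteq> 0"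
      using c(1) False by (intro tendsto_imp_eventually_ne) (auto simp: isCont_def)
    ultimately show ?thesis using that[of 0] False by simp
  next
    case True
    then have nc: "\<not> f constant_on S" using x z unfolding constant_on_def by metis
    obtain g r n where g: "0 < n" "0 < r" "ball \<xi> r \<subseteq> S" "g holomorphic_on ball \<xi> r"
      "\<And>w. w \<in> ball \<xi> r \<Longrightarrow> f w = (w - \<xi>) ^ n * g w" "\<And>w. w \<in> ball \<xi> r \<Longrightarrow> g w \<noteq> 0"
      by (rule holomorphic_factor_zero_nonconstant[OF f x True nc]) (rule that)
    have near: "\<forall>\<^sub>F s in at \<xi>. s \<in> ball \<xi> r - {\<xi>}"
      using g(2) eventually_at_in_open[of "ball \<xi> r" \<xi>] by simp
    have dg: "deriv g holomorphic_on ball \<xi> r" using g by (intro holomorphic_deriv) auto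
    have cg: "isCont g \<xi>" "isCont (deriv g) \<xi>"
      using holomorphic_on_imp_isCont[OF g(4)] holomorphic_on_imp_isCont[OF dg] g(2) by auto
    have "((\<lambda>s. of_nat n + (s - \<xi>) * (deriv g s / g s)) \<longlongrightarrow> of_nat n + (\<xi> - \<xi>) * (deriv g \<xi> / g \<xi>)) (at \<xi>)"
      using cg g(2) g(6)[of \<xi>] by (intro tendsto_intros) (auto simp: isCont_def)
    moreover have "\<forall>\<^sub>F s in at \<xi>. of_nat n + (s - \<xi>) * (deriv g s / g s) = (s - \<xi>) * (deriv f s / f s)"
      using near
    proof eventually_elim
      case (elim s)
      then have s: "s \<in> ball \<xi> r" "s \<noteq> \<xi>" by auto
      have "(g has_field_derivative deriv g s) (at s)"
        using g(4) s by (intro holomorphic_derivI) auto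
      then have "((\<lambda>w. (w - \<xi>) ^ n * g w) has_field_derivative (of_nat n * (s - \<xi>) ^ (n - 1) * g s + (s - \<xi>) ^ n * deriv g s)) (at s)"
        by (auto intro!: derivative_eq_intros)
      then have "(f has_field_derivative (of_nat n * (s - \<xi>) ^ (n - 1) * g s + (s - \<xi>) ^ n * deriv g s)) (at s)"
        by (rule has_field_derivative_transform_within_open[of _ _ _ "ball \<xi> r"]) (use s g(5) in auto)
      then have d: "deriv f s = of_nat n * (s - \<xi>) ^ (n - 1) * g s + (s - \<xi>) ^ n * deriv g s"
        by (rule DERIV_imp_deriv)
      have p: "(s - \<xi>) * (s - \<xi>) ^ (n - 1) = (s - \<xi>) ^ n"
        using g(1) by (metis Suc_diff_1 power_Suc)
      have "(s - \<xi>) * deriv f s = (s - \<xi>) ^ n * (of_nat n * g s + (s - \<xi>) * deriv g s)"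
        unfolding d p[symmetric] by (simp add: algebra_simps)
      then have "(s - \<xi>) * (deriv f s / f s) = (of_nat n * g s + (s - \<xi>) * deriv g s) / g s"
        using s by (simp only: times_divide_eq_right g(5)[OF s(1)]) simp
      then show ?case using g(6)[OF s(1)] by (simp add: add_divide_distrib)
    qed
    ultimately have "((\<lambda>s. (s - \<xi>) * (deriv f s / f s)) \<longlongrightarrow> of_nat n + (\<xi> - \<xi>) * (deriv g \<xi> / g \<xi>)) (at \<xi>)"
      by (rule Lim_transform_eventually)
    then have "((\<lambda>s. (s - \<xi>) * (deriv f s / f s)) \<longlongrightarrow> of_nat n) (at \<xi>)" by simp
    moreover have "\<forall>\<^sub>F s in at \<xi>. f s \<noteq> 0"
      using near
    proof eventually_elim
      case (elim s)
      then have s: "s \<in> ball \<xi> r" "s \<noteq> \<xi>" by auto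
      then show ?case using g(5)[OF s(1)] g(6)[OF s(1)] by simp
    qed
    ultimately show ?thesis using that[of n] g(1) by blast
  qed
qed

text \<open>Away from 1 the summand 1 / (s - 1) stays bounded, so a zero of order \<open>k\<close>
  shows up as residue \<open>- k\<close> when \<open>\<xi>\<close> is approached horizontally from
  the right.\<close>

lemma mangoldt_series_order:
  assumes x: "Re \<xi> \<ge> 1" "\<xi> \<noteq> 1"
  obtains k :: nat where "((\<lambda>h. of_real h * mangoldt_series (\<xi> + of_real h)) \<longlongrightarrow> - of_nat k) (at_right 0)"
    "zeta_pole \<xi> = 0 \<Longrightarrow> k > 0"
proof -
  have "convex {s. Re s > 0}" by (rule convex_halfspace_Re_gt)
  then obtain k :: nat where k: "((\<lambda>s. (s - \<xi>) * (deriv zeta_pole s / zeta_pole s)) \<longlongrightarrow> of_nat k) (at \<xi>)"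
     "zeta_pole \<xi> = 0 \<Longrightarrow> k > 0" "\<forall>\<^sub>F s in at \<xi>. zeta_pole s \<noteq> 0"
    using tendsto_mult_log_deriv[OF holomorphic_zeta_pole open_halfspace_Re_gt convex_connected, of \<xi> 1] x
    by (auto simp: zeta_pole_1)
  have lim: "filterlim (\<lambda>h::real. \<xi> + of_real h) (at \<xi>) (at_right 0)"
  proof (rule filterlim_atI)
    have "((\<lambda>h::real. \<xi> + of_real h) \<longlongrightarrow> \<xi> + of_real 0) (at_right 0)" by (intro tendsto_intros)
    then show "((\<lambda>h::real. \<xi> + of_real h) \<longlongrightarrow> \<xi>) (at_right 0)" by simp
    show "\<forall>\<^sub>F h::real in at_right 0. \<xi> + of_real h \<noteq> \<xi>"
      by (rule eventually_mono[OF eventually_at_right_less]) auto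
  qed
  have "((\<lambda>h. of_real h / (\<xi> + of_real h - 1) - of_real h * (deriv zeta_pole (\<xi> + of_real h) / zeta_pole (\<xi> + of_real h)))
      \<longlongrightarrow> of_real 0 / (\<xi> + of_real 0 - 1) - of_nat k) (at_right 0)"
    using filterlim_compose[OF k(1) lim] x(2) by (intro tendsto_intros) auto
  moreover have "\<forall>\<^sub>F h in at_right 0. of_real h / (\<xi> + of_real h - 1) - of_real h * (deriv zeta_pole (\<xi> + of_real h) / zeta_pole (\<xi> + of_real h))
      = of_real h * mangoldt_series (\<xi> + of_real h)"
    using eventually_compose_filterlim[OF k(3) lim] eventually_at_right_less[of 0]
  proof eventually_elim
    case (elim h)
    define s where "s = \<xi> + of_real h"
    have s: "Re s > 1" using elim x by (simp add: s_def)
    then have "s \<noteq> 1" by auto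
    then have "mangoldt_series s = 1 / (s - 1) - deriv zeta_pole s / zeta_pole s"
      using mangoldt_series_mult_zeta_pole[OF s] elim(1) by (simp add: s_def[symmetric] field_simps)
    then show ?case unfolding s_def[symmetric] by (simp add: right_diff_distrib)
  qed
  ultimately have "((\<lambda>h. of_real h * mangoldt_series (\<xi> + of_real h)) \<longlongrightarrow> of_real 0 / (\<xi> + of_real 0 - 1) - of_nat k) (at_right 0)"
    by (rule Lim_transform_eventually)
  then show ?thesis using that[of k] k(2) by simp
qed

lemma mangoldt_series_pole:
  "((\<lambda>h. of_real h * mangoldt_series (1 + of_real h)) \<longlongrightarrow> 1) (at_right 0)"
proof -
  have op: "open {s. Re s > 0}" by (rule open_halfspace_Re_gt)
  have dz: "deriv zeta_pole holomorphic_on {s. Re s > 0}"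
    using holomorphic_zeta_pole op by (intro holomorphic_deriv)
  have c: "isCont zeta_pole 1" "isCont (deriv zeta_pole) 1"
    using holomorphic_on_imp_isCont[OF holomorphic_zeta_pole op] holomorphic_on_imp_isCont[OF dz op] by auto
  have l: "((\<lambda>h::real. 1 + of_real h) \<longlongrightarrow> (1::complex)) (at_right 0)"
  proof -
    have "((\<lambda>h::real. 1 + of_real h) \<longlongrightarrow> (1 + of_real 0::complex)) (at_right 0)" by (intro tendsto_intros)
    then show ?thesis by simp
  qed
  have z: "((\<lambda>h. zeta_pole (1 + of_real h)) \<longlongrightarrow> 1) (at_right 0)"
    using isCont_tendsto_compose[OF c(1) l] by (simp add: zeta_pole_1)
  have d: "((\<lambda>h. deriv zeta_pole (1 + of_real h)) \<longlongrightarrow> deriv zeta_pole 1) (at_right 0)"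
    by (rule isCont_tendsto_compose[OF c(2) l])
  have "((\<lambda>h. 1 - of_real h * (deriv zeta_pole (1 + of_real h) / zeta_pole (1 + of_real h)))
      \<longlongrightarrow> 1 - of_real 0 * (deriv zeta_pole 1 / 1)) (at_right 0)"
    by (intro tendsto_intros z d) auto
  moreover have "\<forall>\<^sub>F h in at_right 0. zeta_pole (1 + of_real h) \<noteq> 0"
    by (rule tendsto_imp_eventually_ne[OF z]) auto
  then have "\<forall>\<^sub>F h in at_right 0. 1 - of_real h * (deriv zeta_pole (1 + of_real h) / zeta_pole (1 + of_real h))
      = of_real h * mangoldt_series (1 + of_real h)"
    using eventually_at_right_less[of 0]
  proof eventually_elim
    case (elim h)
    then show ?case using mangoldt_series_mult_zeta_pole[of "1 + of_real h"] by (simp add: field_simps)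
  qed
  ultimately have "((\<lambda>h. of_real h * mangoldt_series (1 + of_real h)) \<longlongrightarrow> 1 - of_real 0 * (deriv zeta_pole 1 / 1)) (at_right 0)"
    by (rule Lim_transform_eventually)
  then show ?thesis by simp
qed

text \<open>Termwise this is 3 + 4 cos x + cos 2x = 2 (1 + cos x)^2, applied with x = y ln
  n.\<close>

lemma Re_mangoldt_series_nonneg:
  assumes x: "x > 1"
  shows "Re (3 * mangoldt_series (of_real x) + 4 * mangoldt_series (of_real x + \<i> * of_real y)
     + mangoldt_series (of_real x + \<i> * of_real (2 * y))) \<ge> 0"
proof -
  let ?M = "\<lambda>t n. mangoldt n * of_nat n powr - (of_real x + \<i> * of_real t) :: complex"
  have s: "(\<lambda>n. ?M t n) sums mangoldt_series (of_real x + \<i> * of_real t)" for t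
    by (rule mangoldt_series_sums) (use x in simp)
  have re: "Re (?M t n) = mangoldt n * real n powr - x * cos (t * ln (real n))" for t n
  proof (cases "n = 0")
    case False
    have "(of_nat n :: complex) powr - (of_real x + \<i> * of_real t) = exp (- (of_real x + \<i> * of_real t) * of_real (ln (real n)))"
      using False by (simp add: powr_def Ln_of_nat)
    then have "Re (?M t n) = mangoldt n * Re (exp (- (of_real x + \<i> * of_real t) * of_real (ln (real n))))"
      by simp
    also have "\<dots> = mangoldt n * (exp (- x * ln (real n)) * cos (t * ln (real n)))"
      by (simp add: Re_exp)
    finally show ?thesis using False by (simp add: powr_def)
  qed simp
  have S: "(\<lambda>n. Re (3 * ?M 0 n + 4 * ?M y n + ?M (2 * y) n)) sums
    Re (3 * mangoldt_series (of_real x + \<i> * of_real 0) + 4 * mangoldt_series (of_real x + \<i> * of_real y)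
     + mangoldt_series (of_real x + \<i> * of_real (2 * y)))"
    by (intro sums_Re sums_add sums_mult s)
  have N: "0 \<le> Re (3 * ?M 0 n + 4 * ?M y n + ?M (2 * y) n)" for n
  proof -
    define c where "c = cos (y * ln (real n))"
    have c2: "cos (2 * y * ln (real n)) = 2 * c\<^sup>2 - 1"
      using cos_double_cos[of "y * ln (real n)"] by (simp add: c_def mult.assoc)
    have "Re (3 * ?M 0 n + 4 * ?M y n + ?M (2 * y) n) = 3 * Re (?M 0 n) + 4 * Re (?M y n) + Re (?M (2 * y) n)"
      by simp
    also have "\<dots> = mangoldt n * real n powr - x * (2 * (1 + c)\<^sup>2)"
      unfolding re c2 c_def[symmetric] by (simp add: algebra_simps power2_eq_square)
    also have "\<dots> \<ge> 0" by (simp add: mangoldt_nonneg)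
    finally show ?thesis .
  qed
  have "0 \<le> Re (3 * mangoldt_series (of_real x + \<i> * of_real 0) + 4 * mangoldt_series (of_real x + \<i> * of_real y)
     + mangoldt_series (of_real x + \<i> * of_real (2 * y)))"
    by (rule sums_le[where f = "\<lambda>_. 0", OF N sums_zero S])
  then show ?thesis by simp
qed

text \<open>Multiplying the 3-4-1 inequality by \<open>h\<close> and letting \<open>h\<close> tend
  to 0 gives 3 - 4 k - l \<ge> 0, where k and l are the orders at 1 + iy and 1 + 2iy. This is
  impossible for k \<ge> 1 since l \<ge> 0.\<close>

lemma zeta_pole_nonzero_line: "zeta_pole (1 + \<i> * of_real y) \<noteq> 0"
proof (cases "y = 0")
  case False
  show ?thesis
  proof
    assume zero: "zeta_pole (1 + \<i> * of_real y) = 0"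
    have ne: "1 + \<i> * of_real y \<noteq> 1" "1 + \<i> * of_real (2 * y) \<noteq> 1" using False by (auto simp: complex_eq_iff)
    obtain k :: nat where k: "((\<lambda>h. of_real h * mangoldt_series (1 + \<i> * of_real y + of_real h)) \<longlongrightarrow> - of_nat k) (at_right 0)"
        "zeta_pole (1 + \<i> * of_real y) = 0 \<Longrightarrow> k > 0"
      by (rule mangoldt_series_order[OF _ ne(1)]) (simp, rule that)
    obtain l :: nat where l: "((\<lambda>h. of_real h * mangoldt_series (1 + \<i> * of_real (2 * y) + of_real h)) \<longlongrightarrow> - of_nat l) (at_right 0)"
      by (rule mangoldt_series_order[OF _ ne(2)]) (simp, rule that)
    let ?f = "\<lambda>h. Re (3 * (of_real h * mangoldt_series (1 + of_real h)) + 4 * (of_real h * mangoldt_series (1 + \<i> * of_real y + of_real h))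
       + of_real h * mangoldt_series (1 + \<i> * of_real (2 * y) + of_real h))"
    have "(?f \<longlongrightarrow> Re (3 * 1 + 4 * - of_nat k + - of_nat l)) (at_right 0)"
      by (intro tendsto_intros mangoldt_series_pole k l)
    moreover have "\<forall>\<^sub>F h in at_right 0. ?f h \<ge> 0"
      using eventually_at_right_less[of 0]
    proof eventually_elim
      case (elim h)
      have "0 \<le> h * Re (3 * mangoldt_series (of_real (1 + h)) + 4 * mangoldt_series (of_real (1 + h) + \<i> * of_real y)
          + mangoldt_series (of_real (1 + h) + \<i> * of_real (2 * y)))"
        using Re_mangoldt_series_nonneg[of "1 + h" y] elim by (intro mult_nonneg_nonneg) auto
      also have "\<dots> = ?f h" by (simp add: algebra_simps)
      finally show ?case .
    qed
    ultimately have "Re (3 * 1 + 4 * - of_nat k + - of_nat l) \<ge> 0"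
      by (intro tendsto_lowerbound) auto
    then show False using k(2)[OF zero] by simp
  qed
qed (simp add: zeta_pole_1)

text \<open>To the right of the line no Euler product is used: the von Mangoldt series stays bounded
  on approach to \<open>s\<close>, so the order \<open>k\<close> must be 0.\<close>

lemma zeta_pole_nonzero:
  assumes "Re s \<ge> 1"
  shows "zeta_pole s \<noteq> 0"
proof (cases "Re s = 1")
  case True
  then have "s = 1 + \<i> * of_real (Im s)" by (simp add: complex_eq_iff)
  then show ?thesis using zeta_pole_nonzero_line by metis
next
  case False
  then have s: "Re s > 1" using assms by simp
  then have "s \<noteq> 1" by auto
  obtain k :: nat where k: "((\<lambda>h. of_real h * mangoldt_series (s + of_real h)) \<longlongrightarrow> - of_nat k) (at_right 0)"
    "zeta_pole s = 0 \<Longrightarrow> k > 0"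
    using mangoldt_series_order[OF assms \<open>s \<noteq> 1\<close>] by blast
  have m: "summable (\<lambda>n. mangoldt n * real n powr - Re s)"
    using summable_norm_mangoldt[OF s] by (simp add: norm_mult norm_nat_powr)
  define B where "B = (\<Sum>n. mangoldt n * real n powr - Re s)"
  have "((\<lambda>h. of_real h * mangoldt_series (s + of_real h)) \<longlongrightarrow> 0) (at_right 0)"
  proof (rule Lim_null_comparison)
    show "\<forall>\<^sub>F h in at_right 0. norm (of_real h * mangoldt_series (s + of_real h)) \<le> h * B"
      using eventually_at_right_less[of 0]
    proof eventually_elim
      case (elim h)
      have "norm (mangoldt_series (s + of_real h)) \<le> B"
        unfolding mangoldt_series_def B_def
      proof (rule norm_suminf_le[OF _ m])
        fix n :: nat
        show "norm (mangoldt n * of_nat n powr - (s + of_real h) :: complex) \<le> mangoldt n * real n powr - Re s"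
          using elim by (cases "n = 0")
            (auto simp: norm_mult norm_nat_powr mangoldt_nonneg intro!: mult_left_mono powr_mono)
      qed
      then show ?case using elim by (simp add: norm_mult mult_left_mono)
    qed
    have "((\<lambda>h. h * B) \<longlongrightarrow> 0 * B) (at_right 0)" by (intro tendsto_intros)
    then show "((\<lambda>h. h * B) \<longlongrightarrow> 0) (at_right 0)" by simp
  qed
  then have "- of_nat k = (0::complex)" using k(1) tendsto_unique trivial_limit_at_right_real by blast
  then show ?thesis using k(2) by auto
qed

section \<open>The prime number theorem\<close>

definition chebyshev_psi :: "nat \<Rightarrow> real" where
  "chebyshev_psi n = (\<Sum>k=1..n. mangoldt k)"

lemma chebyshev_psi_0 [simp]: "chebyshev_psi 0 = 0"
  and chebyshev_psi_Suc: "chebyshev_psi (Suc n) = chebyshev_psi n + mangoldt (Suc n)"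
  by (simp_all add: chebyshev_psi_def)

lemma chebyshev_psi_nonneg: "chebyshev_psi n \<ge> 0"
  unfolding chebyshev_psi_def by (intro sum_nonneg mangoldt_nonneg)

lemma chebyshev_psi_mono: "m \<le> n \<Longrightarrow> chebyshev_psi m \<le> chebyshev_psi n"
  unfolding chebyshev_psi_def by (intro sum_mono2 mangoldt_nonneg) auto

text \<open>The range \<open>N\<close> may exceed \<open>n\<close> (the extra quotients are 0), so
  that the formulas for \<open>fact (2 * n)\<close> and \<open>fact n\<close> can be subtracted term
  by term.\<close>

lemma ln_fact_eq_sum_mangoldt:
  assumes "n \<le> N"
  shows "ln (fact n) = (\<Sum>d=1..N. mangoldt d * real (n div d))"
proof -
  have "ln (fact n :: real) = (\<Sum>m=1..n. ln (real m))"
    by (subst fact_prod, subst of_nat_prod, subst ln_prod) auto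
  also have "\<dots> = (\<Sum>m=1..n. \<Sum>d | d dvd m. mangoldt d)"
    by (intro sum.cong refl) (use mangoldt_sum[where ?'a = real] in auto)
  also have "\<dots> = (\<Sum>m=1..n. \<Sum>d=1..N. if d dvd m then mangoldt d else 0)"
  proof (rule sum.cong[OF refl])
    fix m assume m: "m \<in> {1..n}"
    have eq: "{d. d dvd m} = {d\<in>{1..N}. d dvd m}"
    proof (intro equalityI subsetI)
      fix d assume "d \<in> {d. d dvd m}"
      then have "d dvd m" by simp
      moreover have "d \<le> m" "d > 0" using calculation m by (auto intro!: dvd_imp_le intro: dvd_pos_nat)
      ultimately show "d \<in> {d\<in>{1..N}. d dvd m}" using m assms by simp
    qed auto
    show "(\<Sum>d | d dvd m. mangoldt d :: real) = (\<Sum>d=1..N. if d dvd m then mangoldt d else 0)"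
      unfolding eq by (rule sum.inter_filter) simp
  qed
  also have "\<dots> = (\<Sum>d=1..N. \<Sum>m=1..n. if d dvd m then mangoldt d else 0)"
    by (rule sum.swap)
  also have "\<dots> = (\<Sum>d=1..N. mangoldt d * real (n div d))"
  proof (rule sum.cong[OF refl])
    fix d assume d: "d \<in> {1..N}"
    have "{m\<in>{1..n}. d dvd m} = (\<lambda>k. d * k) ` {1..n div d}"
    proof (intro equalityI subsetI)
      fix m assume m: "m \<in> {m\<in>{1..n}. d dvd m}"
      then obtain k where k: "m = d * k" by auto
      then have "k \<in> {1..n div d}" using m d by (auto simp: less_eq_div_iff_mult_less_eq mult.commute intro: Nat.gr0I)
      then show "m \<in> (\<lambda>k. d * k) ` {1..n div d}" using k by blast
    next
      fix m assume "m \<in> (\<lambda>k. d * k) ` {1..n div d}"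
      then obtain k where "m = d * k" "k \<in> {1..n div d}" by (elim imageE)
      then have k: "m = d * k" "k \<ge> 1" "k \<le> n div d" by simp_all
      then have "m \<le> n" using d by (simp add: less_eq_div_iff_mult_less_eq mult.commute)
      then show "m \<in> {m\<in>{1..n}. d dvd m}" using k d by auto
    qed
    moreover have "inj_on (\<lambda>k. d * k) {1..n div d}" using d by (auto intro!: inj_onI)
    ultimately have "card {m\<in>{1..n}. d dvd m} = n div d" by (simp only: card_image) simp
    then show "(\<Sum>m=1..n. if d dvd m then mangoldt d else 0) = mangoldt d * real (n div d)"
      by (subst sum.inter_filter[symmetric]) auto
  qed
  finally show ?thesis .
qed

text \<open>Chebyshev's argument: in the logarithm of the central binomial coefficient all
  multiplicities are nonnegative, and those of n < d \<le> 2 n are at least 1.\<close>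

lemma chebyshev_psi_double: "chebyshev_psi (2 * n) \<le> chebyshev_psi n + 2 * real n * ln 2"
proof -
  have "chebyshev_psi (2 * n) - chebyshev_psi n = (\<Sum>d\<in>{1..2*n} - {1..n}. mangoldt d)"
    unfolding chebyshev_psi_def by (subst sum_diff) auto
  also have "\<dots> = (\<Sum>d\<in>{1..2*n}. mangoldt d * (if d > n then 1 else 0))"
    by (rule sum.mono_neutral_cong_left) auto
  also have "\<dots> \<le> (\<Sum>d=1..2*n. mangoldt d * (real (2 * n div d) - 2 * real (n div d)))"
  proof (intro sum_mono mult_left_mono mangoldt_nonneg)
    fix d assume d: "d \<in> {1..2*n}"
    have "2 * (n div d) \<le> 2 * n div d"
      using d div_times_less_eq_dividend[of n d] by (simp add: less_eq_div_iff_mult_less_eq)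
    then have "real (2 * n div d) - 2 * real (n div d) \<ge> 0" by linarith
    moreover have "2 * n div d \<ge> 1" if "d > n" using d that by (simp add: less_eq_div_iff_mult_less_eq)
    ultimately show "(if d > n then 1 else 0) \<le> real (2 * n div d) - 2 * real (n div d)"
      by auto
  qed
  also have "\<dots> = ln (fact (2 * n)) - 2 * ln (fact n)"
    unfolding ln_fact_eq_sum_mangoldt[of n "2 * n", simplified] ln_fact_eq_sum_mangoldt[of "2 * n" "2 * n", simplified]
    by (simp add: right_diff_distrib sum_subtractf sum_distrib_left mult_ac)
  also have "\<dots> = ln (real (2 * n choose n))"
  proof -
    have "real (2 * n choose n) = fact (2 * n) / (fact n * fact n)"
      by (subst binomial_fact) (auto simp: mult_2)
    then show ?thesis by (simp add: ln_div ln_mult)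
  qed
  also have "\<dots> \<le> ln (2 ^ (2 * n))"
  proof (rule ln_mono)
    show "real (2 * n choose n) \<le> 2 ^ (2 * n)"
      using binomial_le_pow2[of "2 * n" n] by (metis of_nat_le_iff of_nat_numeral of_nat_power)
  qed (auto simp: zero_less_binomial)
  also have "\<dots> = 2 * real n * ln 2" by (simp add: ln_realpow)
  finally show ?thesis by simp
qed

text \<open>The constant 4 is what the odd case n = 2 m + 1 asks for with crude logarithm bounds: 4
  m from the induction hypothesis, 2 m from doubling and 2 m from the last term give 8 m \<le> 4
  n.\<close>

lemma chebyshev_psi_le: "chebyshev_psi n \<le> 4 * real n"
proof (induction n rule: less_induct)
  case (less n)
  have l2: "ln (2::real) \<le> 1" using ln_le_minus_one[of 2] by simp
  consider "n = 0" | m where "n = 2 * m" "m > 0" | m where "n = Suc (2 * m)"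
    by (metis mult_0_right not_gr0 oddE Suc_eq_plus1 evenE)
  then show ?case
  proof cases
    case 2
    then have "chebyshev_psi n \<le> 4 * real m + 2 * real m * ln 2"
      using chebyshev_psi_double[of m] less.IH[of m] by simp
    also have "\<dots> \<le> 4 * real m + 2 * real m * 1" by (intro add_mono mult_left_mono l2) auto
    finally show ?thesis using 2 by simp
  next
    case 3
    have "chebyshev_psi n \<le> chebyshev_psi (2 * m) + ln (real (Suc (2 * m)))"
      using mangoldt_le_ln[of "Suc (2 * m)"] 3 by (simp add: chebyshev_psi_Suc)
    moreover have "ln (real (Suc (2 * m))) \<le> 2 * real m"
      using ln_le_minus_one[of "real (Suc (2 * m))"] by simp
    moreover have "chebyshev_psi m \<le> 4 * real m"
      using less.IH[of m] 3 by simp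
    moreover have "2 * real m * ln 2 \<le> 2 * real m * 1" by (intro mult_left_mono l2) auto
    ultimately show ?thesis using chebyshev_psi_double[of m] 3 by simp
  qed simp
qed

section \<open>Newman's theorem for Dirichlet series\<close>

definition step_kernel :: "nat \<Rightarrow> complex \<Rightarrow> complex" where
  "step_kernel n s = (of_nat (Suc n) powr - s - of_nat (n + 2) powr - s) / s"

text \<open>The removable singularity is filled in because, after the shift
  \<open>s = 1 + z\<close>, it sits at \<open>z = -1\<close>, inside the circle of Newman's
  argument, whose terms must be entire.\<close>

definition step_kernel_entire :: "nat \<Rightarrow> complex \<Rightarrow> complex" where
  "step_kernel_entire n s = (if s = 0 then deriv (\<lambda>s. of_nat (Suc n) powr - s - of_nat (n + 2) powr - s) 0
     else step_kernel n s)"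

lemma holomorphic_step_kernel_entire: "step_kernel_entire n holomorphic_on UNIV"
proof -
  let ?u = "\<lambda>s. of_nat (Suc n) powr - s - of_nat (n + 2) powr - s :: complex"
  have "?u holomorphic_on UNIV" by (intro holomorphic_intros)
  from pole_lemma_open[OF this open_UNIV, of 0]
  have "(\<lambda>z. if z = 0 then deriv ?u 0 else (?u z - ?u 0) / (z - 0)) holomorphic_on UNIV" .
  moreover have z: "?u 0 = 0" by (simp del: of_nat_Suc of_nat_add)
  have "step_kernel_entire n = (\<lambda>z. if z = 0 then deriv ?u 0 else (?u z - ?u 0) / (z - 0))"
    unfolding step_kernel_entire_def step_kernel_def z by (rule ext) simp
  ultimately show ?thesis by simp
qed

text \<open>\<open>step_kernel n s\<close> is the integral of \<open>x\<^sup>-\<^sup>s\<^sup>-\<^sup>1\<close> over \<open>[n + 1, n + 2]\<close>, and \<open>(n + 1) x\<^sup>-\<^sup>s\<^sup>-\<^sup>1 \<le> x\<^sup>-\<^sup>s\<close> there.\<close>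
lemma norm_step_kernel_le:
  assumes z: "Re z \<noteq> 0" "z \<noteq> -1"
  shows "real (Suc n) * norm (step_kernel n (1 + z)) \<le> (real (Suc n) powr - Re z - real (n + 2) powr - Re z) / Re z"
proof -
  define s where "s = 1 + z"
  have s: "s \<noteq> 0" using z by (simp add: s_def add_eq_0_iff)
  define a where "a = real (Suc n)"
  have a: "a > 0" by (simp add: a_def)
  define f where "f = (\<lambda>x::real. - (of_real x powr - s) / s)"
  \<comment> \<open>A real majorant for \<open>f\<close>: its derivative
    \<open>x powr (- Re z - 1) / a\<close> dominates the norm \<open>x powr (- Re z - 1) / x\<close>
    of the derivative of \<open>f\<close>, because \<open>a \<le> x\<close>.\<close>
  define g where "g = (\<lambda>x::real. - (x powr - Re z) / (Re z * a))"
  have df: "(f has_vector_derivative of_real x powr (- s - 1)) (at x)" if "x > 0" for x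
  proof -
    have "((\<lambda>w. - (w powr - s) / s) has_field_derivative (of_real x powr (- s - 1))) (at (of_real x))"
      using that s by (auto intro!: derivative_eq_intros simp: complex_nonpos_Reals_iff)
    then have "((\<lambda>x. - (of_real x powr - s) / s) has_vector_derivative (of_real x powr (- s - 1))) (at x)"
      by (rule has_vector_derivative_real_field)
    then show ?thesis by (simp add: f_def)
  qed
  have dg: "(g has_vector_derivative x powr (- Re z - 1) / a) (at x)" if "x > 0" for x
  proof -
    have "(g has_real_derivative x powr (- Re z - 1) / a) (at x)"
      unfolding g_def using that z a by (auto intro!: derivative_eq_intros simp: field_simps)
    then show ?thesis by (simp add: has_real_derivative_iff_has_vector_derivative)
  qed
  have "norm (f (a + 1) - f a) \<le> g (a + 1) - g a"
  proof (rule differentiable_bound_general)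
    show "continuous_on {a..a + 1} f" "continuous_on {a..a + 1} g"
      using a by (auto intro!: continuous_at_imp_continuous_on has_vector_derivative_continuous[OF df]
          has_vector_derivative_continuous[OF dg])
    fix x assume x: "a < x" "x < a + 1"
    then show "(f has_vector_derivative of_real x powr (- s - 1)) (at x)" "(g has_vector_derivative x powr (- Re z - 1) / a) (at x)"
      using df dg a by auto
    have "norm (of_real x powr (- s - 1) :: complex) = x powr (- Re z - 1 - 1)"
      using x a by (simp add: norm_powr_real_powr s_def)
    also have "\<dots> = x powr (- Re z - 1) / x"
      using x a by (subst powr_diff) auto
    also have "\<dots> \<le> x powr (- Re z - 1) / a"
      using x a by (intro divide_left_mono) auto
    finally show "norm (of_real x powr (- s - 1) :: complex) \<le> x powr (- Re z - 1) / a" .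
  qed simp
  moreover have "f (a + 1) - f a = step_kernel n s"
    by (simp add: f_def step_kernel_def a_def diff_divide_distrib add.commute)
  ultimately have "a * norm (step_kernel n s) \<le> a * (g (a + 1) - g a)"
    using a by (intro mult_left_mono) auto
  also have "\<dots> = (a powr - Re z - (a + 1) powr - Re z) / Re z"
    using a z by (simp add: g_def field_simps)
  finally show ?thesis by (simp add: a_def s_def add_ac)
qed

text \<open>Changing \<open>b 1\<close> subtracts a multiple of the first kernel from \<open>F\<close>, which reduces to \<open>F 0 = 0\<close>.\<close>
lemma newman_dirichlet:
  fixes b :: "nat \<Rightarrow> complex" and C :: real
  assumes b: "\<And>n. norm (b (Suc n)) \<le> C * real (Suc n)"
    and F: "F holomorphic_on U" "open U" "{z. Re z \<ge> 0} \<subseteq> U"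
    and bF: "\<And>z. Re z > 0 \<Longrightarrow> (\<lambda>n. b (Suc n) * step_kernel n (1 + z)) sums F z"
  shows "(\<lambda>n. b (Suc n) * step_kernel n 1) sums F 0"
proof -
  \<comment> \<open>The factor 2 offsets \<open>step_kernel 0 1 = 1 / 2\<close>, so exactly
    \<open>F 0\<close> is removed from the value at \<open>z = 0\<close>.\<close>
  define b' where "b' = (\<lambda>n. b n - (if n = 1 then 2 * F 0 else 0))"
  define C' where "C' = C + norm (2 * F 0)"
  have b'_eq: "b' (Suc n) * w = b (Suc n) * w - (if n = 0 then 2 * F 0 * w else 0)" for n w
    by (simp add: b'_def left_diff_distrib)
  have half: "step_kernel 0 1 = 1 / 2"
    by (simp add: step_kernel_def powr_minus)
  have hol: "(\<lambda>z. step_kernel_entire n (1 + z)) holomorphic_on A" for n A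
  proof -
    have "(step_kernel_entire n \<circ> (\<lambda>z. 1 + z)) holomorphic_on A"
      by (rule holomorphic_on_compose_gen[OF _ holomorphic_step_kernel_entire]) (auto intro!: holomorphic_intros)
    then show ?thesis by (simp add: o_def)
  qed
  have e: "step_kernel_entire n (1 + z) = step_kernel n (1 + z)" if "z \<noteq> -1" for n z
    using that by (simp add: step_kernel_entire_def add_eq_0_iff)
  have "(\<lambda>n. (\<lambda>n z. b' (Suc n) * step_kernel_entire n (1 + z)) n 0) sums 0"
  proof (rule newman_zero)
    show "(\<lambda>z. b' (Suc n) * step_kernel_entire n (1 + z)) holomorphic_on UNIV" for n
      by (intro holomorphic_intros hol)
    show "(\<lambda>z. F z - 2 * F 0 * step_kernel_entire 0 (1 + z)) holomorphic_on U"
      by (intro holomorphic_intros hol F)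
    show "F 0 - 2 * F 0 * step_kernel_entire 0 (1 + 0) = 0"
      by (subst e) (simp_all add: half)
    show "(\<lambda>n. b' (Suc n) * step_kernel_entire n (1 + z)) sums (F z - 2 * F 0 * step_kernel_entire 0 (1 + z))" if "Re z > 0" for z
    proof -
      have "z \<noteq> -1" using that by auto
      then have "(\<lambda>n. b (Suc n) * step_kernel_entire n (1 + z)) sums F z"
        using bF[OF that] e by simp
      from sums_diff[OF this sums_single[of 0 "\<lambda>n. 2 * F 0 * step_kernel_entire n (1 + z)"]]
      show ?thesis by (simp only: b'_eq)
    qed
    fix n z assume z: "Re z \<noteq> 0" "z \<noteq> -1"
    have "C \<ge> 0" using order_trans[OF norm_ge_zero b[of 0]] by simp
    have "norm (b' (Suc n)) \<le> C' * real (Suc n)"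
    proof (cases "n = 0")
      case True
      then have "norm (b' (Suc n)) \<le> norm (b (Suc n)) + norm (2 * F 0)"
        unfolding b'_def using norm_triangle_ineq4[of "b (Suc n)" "2 * F 0"] by simp
      then show ?thesis using b[of n] True by (simp add: C'_def)
    next
      case False
      then have "norm (b' (Suc n)) \<le> C * real (Suc n)" using b[of n] by (simp add: b'_def)
      also have "\<dots> \<le> C' * real (Suc n)" by (intro mult_right_mono) (auto simp: C'_def)
      finally show ?thesis .
    qed
    then have "norm (b' (Suc n) * step_kernel_entire n (1 + z)) \<le> C' * real (Suc n) * norm (step_kernel n (1 + z))"
      unfolding norm_mult e[OF z(2)] by (rule mult_right_mono) simp
    also have "\<dots> = C' * (real (Suc n) * norm (step_kernel n (1 + z)))" by (simp add: mult.assoc)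
    also have "\<dots> \<le> C' * ((real (Suc n) powr - Re z - real (n + 2) powr - Re z) / Re z)"
      by (rule mult_left_mono[OF norm_step_kernel_le[OF z]]) (use \<open>C \<ge> 0\<close> in \<open>simp add: C'_def\<close>)
    finally show "norm (b' (Suc n) * step_kernel_entire n (1 + z)) \<le> C' * ((real (Suc n) powr - Re z - real (n + 2) powr - Re z) / Re z)" .
  qed (use F in auto)
  then have "(\<lambda>n. b' (Suc n) * step_kernel n 1) sums 0"
    using e[of 0] by simp
  from sums_add[OF this sums_single[of 0 "\<lambda>n. 2 * F 0 * step_kernel n 1"]]
  show ?thesis by (simp add: b'_eq half cong: if_cong)
qed

text \<open>Summation by parts turns coefficients into partial sums; the boundary term vanishes
  because \<open>A\<close> grows at most linearly and \<open>Re s > 1\<close>. Division by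
  \<open>s\<close> matches the normalisation of \<open>step_kernel\<close>.\<close>

lemma abel_sums:
  fixes a :: "nat \<Rightarrow> complex" and C :: real
  defines "A \<equiv> \<lambda>n. \<Sum>k=1..n. a k"
  assumes A: "\<And>n. norm (A n) \<le> C * real n" and s: "Re s > 1"
    and sm: "(\<lambda>n. a n * of_nat n powr - s) sums S"
  shows "(\<lambda>n. A (Suc n) * step_kernel n s) sums (S / s)"
proof -
  let ?p = "\<lambda>n. of_nat n powr - s :: complex"
  have fin: "(\<Sum>n<N. a (Suc n) * ?p (Suc n)) = (\<Sum>n<N. A (Suc n) * (?p (Suc n) - ?p (n + 2))) + A N * ?p (Suc N)" for N
  proof (induction N)
    case (Suc N)
    have "A (Suc N) = A N + a (Suc N)" by (simp add: A_def)
    then show ?case using Suc by (simp add: algebra_simps del: of_nat_Suc)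
  qed (simp add: A_def)
  have 0: "(\<lambda>N. A N * ?p (Suc N)) \<longlonglongrightarrow> 0"
  proof (rule Lim_null_comparison)
    show "\<forall>\<^sub>F N in sequentially. norm (A N * ?p (Suc N)) \<le> C * real N * real (Suc N) powr - Re s"
      using A by (intro always_eventually allI) (simp add: norm_mult norm_nat_powr mult_right_mono del: of_nat_Suc)
    show "(\<lambda>N. C * real N * real (Suc N) powr - Re s) \<longlonglongrightarrow> 0"
      using s by real_asymp
  qed
  have "(\<lambda>n. a (Suc n) * ?p (Suc n)) sums (S - a 0 * ?p 0)"
    using sm by (subst sums_Suc_iff) simp
  then have "(\<lambda>N. \<Sum>n<N. a (Suc n) * ?p (Suc n)) \<longlonglongrightarrow> S"
    by (simp add: sums_def)
  from tendsto_diff[OF this 0] have "(\<lambda>n. A (Suc n) * (?p (Suc n) - ?p (n + 2))) sums S"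
    unfolding fin sums_def by simp
  from sums_divide[OF this, of s] show ?thesis by (simp add: step_kernel_def)
qed

text \<open>The coefficients \<open>mangoldt n - 1\<close> have the Dirichlet series -zeta'/zeta -
  zeta, in which the poles at 1 cancel. Division by s gives the function to which Newman's theorem
  applies, and at \<open>s = 1\<close> the kernel is 1 / ((n + 1) (n + 2)).\<close>

lemma summable_psi_minus_id:
  "summable (\<lambda>n. (chebyshev_psi n - real n) / (real n * real (Suc n)))"
proof -
  define b where "b = (\<lambda>n. of_real (chebyshev_psi n - real n) :: complex)"
  have b_eq: "b n = (\<Sum>k=1..n. mangoldt k - 1)" for n
    by (simp add: b_def chebyshev_psi_def sum_subtractf)
  have b_le: "norm (b n) \<le> 4 * real n" for n
    unfolding b_def norm_of_real using chebyshev_psi_le[of n] chebyshev_psi_nonneg[of n] by linarith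
  \<comment> \<open>\<open>Q\<close> is zeta without its pole: zeta = 1 / (s - 1) +
    \<open>Q\<close>, and the same 1 / (s - 1) occurs in -zeta'/zeta.\<close>
  define Q where "Q = (\<lambda>s. if s = 1 then deriv zeta_pole 1 else (zeta_pole s - zeta_pole 1) / (s - 1))"
  define G where "G = (\<lambda>s. (- deriv zeta_pole s / zeta_pole s - Q s) / s)"
  have op: "open {s. Re s > 0}" by (rule open_halfspace_Re_gt)
  have Q: "Q holomorphic_on {s. Re s > 0}"
    unfolding Q_def by (rule pole_lemma_open[OF holomorphic_zeta_pole op])
  define V where "V = {s. Re s > 0} \<inter> zeta_pole -` (- {0})"
  have V: "open V" unfolding V_def
    by (intro continuous_open_preimage holomorphic_on_imp_continuous_on holomorphic_zeta_pole op) auto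
  have G: "G holomorphic_on V"
  proof -
    have sub: "V \<subseteq> {s. Re s > 0}" by (auto simp: V_def)
    have "deriv zeta_pole holomorphic_on {s. Re s > 0}"
      by (rule holomorphic_deriv[OF holomorphic_zeta_pole op])
    from holomorphic_on_subset[OF this sub] holomorphic_on_subset[OF holomorphic_zeta_pole sub] holomorphic_on_subset[OF Q sub]
    show ?thesis unfolding G_def
      by (intro holomorphic_on_divide holomorphic_on_diff holomorphic_on_minus holomorphic_on_ident) (auto simp: V_def)
  qed
  define U where "U = (\<lambda>z. 1 + z) -` V"
  have U: "open U" unfolding U_def by (intro open_vimage V continuous_intros)
  have F: "(\<lambda>z. G (1 + z)) holomorphic_on U"
  proof -
    have "(G \<circ> (\<lambda>z. 1 + z)) holomorphic_on U"
      by (rule holomorphic_on_compose_gen[OF _ G]) (auto intro!: holomorphic_intros simp: U_def)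
    then show ?thesis by (simp add: o_def)
  qed
  have "(\<lambda>n. b (Suc n) * step_kernel n 1) sums (\<lambda>z. G (1 + z)) 0"
  proof (rule newman_dirichlet[OF b_le F U])
    show "{z. 0 \<le> Re z} \<subseteq> U" using zeta_pole_nonzero by (auto simp: U_def V_def)
    fix z assume z: "Re z > 0"
    define s where "s = 1 + z"
    have s: "Re s > 1" using z by (simp add: s_def)
    then have s1: "s \<noteq> 1" by auto
    have nz: "zeta_pole s \<noteq> 0" using zeta_pole_nonzero s by simp
    have m: "mangoldt_series s = 1 / (s - 1) - deriv zeta_pole s / zeta_pole s"
      using mangoldt_series_mult_zeta_pole[OF s] nz by (simp add: field_simps)
    have zt: "zeta_series s = zeta_pole s / (s - 1)"
      using zeta_pole_eq[OF s] s1 by simp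
    have "(\<lambda>n. (mangoldt n - 1) * of_nat n powr - s) sums (mangoldt_series s - zeta_series s)"
      using sums_diff[OF mangoldt_series_sums[OF s] zeta_series_sums[OF s]] by (simp add: left_diff_distrib)
    from abel_sums[OF _ s this, of 4] b_le
    have "(\<lambda>n. b (Suc n) * step_kernel n s) sums ((mangoldt_series s - zeta_series s) / s)"
      unfolding b_eq by simp
    also have "mangoldt_series s - zeta_series s = - deriv zeta_pole s / zeta_pole s - Q s"
      unfolding m zt Q_def using s1 by (simp add: zeta_pole_1 diff_divide_distrib)
    finally show "(\<lambda>n. b (Suc n) * step_kernel n (1 + z)) sums G (1 + z)"
      by (simp add: G_def s_def)
  qed
  then have "summable (\<lambda>n. b (Suc n) * step_kernel n 1)" by (simp add: sums_iff)
  moreover have "b (Suc n) * step_kernel n 1 = of_real ((chebyshev_psi (Suc n) - real (Suc n)) / (real (Suc n) * real (Suc (Suc n))))" for n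
  proof -
    have "step_kernel n 1 = 1 / of_nat (Suc n) - 1 / of_nat (Suc (Suc n))"
      unfolding step_kernel_def by (simp add: powr_minus field_simps del: of_nat_Suc)
    also have "\<dots> = of_real (1 / real (Suc n) - 1 / real (Suc (Suc n)))" by simp
    also have "1 / real (Suc n) - 1 / real (Suc (Suc n)) = 1 / (real (Suc n) * real (Suc (Suc n)))"
      by (simp add: field_simps)
    finally show ?thesis unfolding b_def by (simp only: of_real_mult[symmetric]) simp
  qed
  ultimately have "summable (\<lambda>n. complex_of_real ((chebyshev_psi (Suc n) - real (Suc n)) / (real (Suc n) * real (Suc (Suc n)))))"
    by simp
  then have "summable (\<lambda>n. (chebyshev_psi (Suc n) - real (Suc n)) / (real (Suc n) * real (Suc (Suc n))))"
    using summable_Re by fastforce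
  then show ?thesis by (subst summable_Suc_iff[symmetric])
qed

section \<open>From the convergent series to theta(n) ~ n\<close>

lemma sum_inverse_consecutive:
  assumes "1 \<le> m" "m \<le> M"
  shows "(\<Sum>k\<in>{m..<M}. 1 / (real k * real (Suc k))) = 1 / real m - 1 / real M"
  using assms(2)
proof (induction M rule: dec_induct)
  case (step n)
  then have "real n > 0" using assms by simp
  then have "1 / (real n * real (Suc n)) = 1 / real n - 1 / real (Suc n)" by (simp add: field_simps)
  then show ?case using step by simp
qed simp

lemma exists_nat_between:
  fixes a b :: real
  assumes "0 \<le> a" "a + 1 \<le> b"
  obtains n :: nat where "a \<le> real n" "real n \<le> b"
proof (rule that[of "nat \<lceil>a\<rceil>"])
  show "a \<le> real (nat \<lceil>a\<rceil>)" "real (nat \<lceil>a\<rceil>) \<le> b" using assms by linarith+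
qed

text \<open>Monotonicity makes a deviation of \<open>g\<close> at one \<open>m\<close> persist over
  a block of length proportional to \<open>m\<close>. On it the weights 1 / (k (k + 1)) turn the
  deviation into a fixed positive amount, against the Cauchy criterion.\<close>

lemma tendsto_1_of_summable_mono:
  fixes g :: "nat \<Rightarrow> real"
  assumes mono: "\<And>m n. m \<le> n \<Longrightarrow> g m \<le> g n"
    and sm: "summable (\<lambda>n. (g n - real n) / (real n * real (Suc n)))"
  shows "(\<lambda>n. g n / real n) \<longlonglongrightarrow> 1"
proof -
  let ?f = "\<lambda>n. (g n - real n) / (real n * real (Suc n))"
  have ev: "\<forall>\<^sub>F m in sequentially. g m < (1 + \<delta>) * real m \<and> g m > (1 - \<delta>) * real m"
    if \<delta>: "0 < \<delta>" "\<delta> \<le> 1" for \<delta>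
  proof -
    have "\<delta>\<^sup>2 / 16 > 0" using \<delta> by simp
    \<comment> \<open>A bad \<open>m\<close> forces a block sum of at least (\<delta> / 2) (\<delta>
      / 8): the excess stays above \<delta> m / 2 up to some M with 1 - m / M \<ge> \<delta> / 8,
      and the lower case yields even more. The later condition m \<ge> 4 / \<delta> leaves room for
      an integer M, and m \<ge> 2 N keeps the lower block, which starts at M \<ge> m / 2, beyond
      N.\<close>
    then obtain N where N: "\<And>m n. m \<ge> N \<Longrightarrow> norm (sum ?f {m..<n}) < \<delta>\<^sup>2 / 16"
      using sm unfolding summable_Cauchy by blast
    have "\<forall>\<^sub>F m in sequentially. m \<ge> N \<and> m \<ge> 1 \<and> real m \<ge> 4 / \<delta> \<and> real m \<ge> 2 * real N"
      by (intro eventually_conj eventually_ge_at_top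
          filterlim_at_top[THEN iffD1, OF filterlim_real_sequentially, rule_format])
    then show ?thesis
    proof eventually_elim
      case (elim m)
      then have m: "m \<ge> N" "m \<ge> 1" "real m > 0" "\<delta> * real m \<ge> 4" "real m \<ge> 2 * real N"
        using \<delta> by (auto simp: field_simps)
      have "g m < (1 + \<delta>) * real m"
      proof (rule ccontr)
        assume "\<not> g m < (1 + \<delta>) * real m"
        then have gm: "g m \<ge> (1 + \<delta>) * real m" by simp
        have "(1 + \<delta> / 4) * real m + 1 \<le> (1 + \<delta> / 2) * real m" "0 \<le> (1 + \<delta> / 4) * real m"
          using m \<delta> by (simp_all add: algebra_simps)
        then obtain M :: nat where M: "(1 + \<delta> / 4) * real m \<le> real M" "real M \<le> (1 + \<delta> / 2) * real m"
          using exists_nat_between by metis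
        have "0 \<le> \<delta> / 4 * real m" using \<delta> by simp
        then have "m \<le> M" using M(1) unfolding distrib_right by linarith
        have "\<delta> / 8 \<le> 1 - real m / real M"
        proof -
          have "(\<delta> / 8) * real M \<le> (\<delta> / 8) * ((1 + \<delta> / 2) * real m)" by (rule mult_left_mono[OF M(2)]) (use \<delta> in simp)
          also have "\<dots> \<le> (\<delta> / 8) * (2 * real m)" using \<delta> by (intro mult_left_mono mult_right_mono) auto
          also have "\<dots> \<le> real M - real m" using M(1) by (simp add: algebra_simps)
          finally show ?thesis using m(2) \<open>m \<le> M\<close> by (simp add: field_simps)
        qed
        then have "\<delta>\<^sup>2 / 16 \<le> (\<delta> / 2) * (1 - real m / real M)"
          using mult_left_mono[of "\<delta> / 8" _ "\<delta> / 2"] \<delta> by (simp add: power2_eq_square)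
        also have "\<dots> = (\<delta> / 2 * real m) * (1 / real m - 1 / real M)"
          using m(3) \<open>m \<le> M\<close> by (simp add: field_simps)
        also have "\<dots> = (\<Sum>k\<in>{m..<M}. (\<delta> / 2 * real m) * (1 / (real k * real (Suc k))))"
          unfolding sum_distrib_left[symmetric] sum_inverse_consecutive[OF m(2) \<open>m \<le> M\<close>] ..
        also have "\<dots> \<le> sum ?f {m..<M}"
        proof (rule sum_mono)
          fix k assume k: "k \<in> {m..<M}"
          then have "real k \<le> (1 + \<delta> / 2) * real m" using M(2) by auto
          moreover have "g k \<ge> (1 + \<delta>) * real m" using gm mono[of m k] k by auto
          ultimately have "\<delta> / 2 * real m \<le> g k - real k" by (simp add: algebra_simps)
          then have "(\<delta> / 2 * real m) / (real k * real (Suc k)) \<le> ?f k"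
            by (intro divide_right_mono) auto
          then show "(\<delta> / 2 * real m) * (1 / (real k * real (Suc k))) \<le> ?f k"
            by (simp only: times_divide_eq_right mult_1_right)
        qed
        also have "\<dots> \<le> norm (sum ?f {m..<M})" by simp
        finally show False using N[OF m(1), of M] by simp
      qed
      moreover have "g m > (1 - \<delta>) * real m"
      proof (rule ccontr)
        assume "\<not> g m > (1 - \<delta>) * real m"
        then have gm: "g m \<le> (1 - \<delta>) * real m" by simp
        have "(1 - \<delta> / 2) * real m + 1 \<le> (1 - \<delta> / 4) * real m" "0 \<le> (1 - \<delta> / 2) * real m"
          using m \<delta> by (simp_all add: algebra_simps)
        then obtain M :: nat where M: "(1 - \<delta> / 2) * real m \<le> real M" "real M \<le> (1 - \<delta> / 4) * real m"
          using exists_nat_between by metis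
        have "1 / 2 * real m \<le> (1 - \<delta> / 2) * real m" using \<delta> by (intro mult_right_mono) auto
        then have M2: "real M \<ge> real m / 2" using M(1) by simp
        then have MN: "M \<ge> N" using m(5) by simp
        have M1: "M \<ge> 1" using M2 m(3) by (cases M) auto
        have "0 \<le> \<delta> / 4 * real m" using \<delta> by simp
        then have "M \<le> m" using M(2) unfolding left_diff_distrib by linarith
        have "\<delta> / 4 * real M \<le> \<delta> / 4 * real m" using \<delta> \<open>M \<le> m\<close> by (intro mult_left_mono) auto
        then have "\<delta> / 4 \<le> real m / real M - 1"
          using M(2) M1 by (simp add: field_simps)
        then have "(\<delta> / 2) * (\<delta> / 4) \<le> (\<delta> / 2) * (real m / real M - 1)"
          using \<delta> by (intro mult_left_mono) auto
        moreover have "\<delta>\<^sup>2 / 16 \<le> (\<delta> / 2) * (\<delta> / 4)" using \<delta> by (simp add: power2_eq_square)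
        ultimately have "\<delta>\<^sup>2 / 16 \<le> (\<delta> / 2) * (real m / real M - 1)" by linarith
        also have "\<dots> = (\<delta> / 2 * real m) * (1 / real M - 1 / real m)"
          using m(3) M1 by (simp add: field_simps)
        also have "\<dots> = (\<Sum>k\<in>{M..<m}. (\<delta> / 2 * real m) * (1 / (real k * real (Suc k))))"
          unfolding sum_distrib_left[symmetric] sum_inverse_consecutive[OF M1 \<open>M \<le> m\<close>] ..
        also have "\<dots> \<le> (\<Sum>k\<in>{M..<m}. - ?f k)"
        proof (rule sum_mono)
          fix k assume k: "k \<in> {M..<m}"
          then have "real k \<ge> (1 - \<delta> / 2) * real m" using M(1) by auto
          moreover have "g k \<le> (1 - \<delta>) * real m" using gm mono[of k m] k by auto
          ultimately have "\<delta> / 2 * real m \<le> - (g k - real k)" by (simp add: algebra_simps)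
          then have "(\<delta> / 2 * real m) / (real k * real (Suc k)) \<le> - (g k - real k) / (real k * real (Suc k))"
            by (intro divide_right_mono) auto
          then show "(\<delta> / 2 * real m) * (1 / (real k * real (Suc k))) \<le> - ?f k"
            by (simp only: minus_divide_left times_divide_eq_right mult_1_right)
        qed
        also have "\<dots> = - sum ?f {M..<m}" by (rule sum_negf)
        also have "\<dots> \<le> norm (sum ?f {M..<m})" by simp
        finally show False using N[OF MN, of m] by simp
      qed
      ultimately show ?case by blast
    qed
  qed
  show ?thesis
  proof (rule tendstoI)
    fix e :: real assume "e > 0"
    then have "0 < min e 1" "min e 1 \<le> 1" by auto
    from ev[OF this] eventually_gt_at_top[of 0]
    show "\<forall>\<^sub>F n in sequentially. dist (g n / real n) 1 < e"
    proof eventually_elim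
      case (elim n)
      then have "g n / real n < 1 + min e 1" "g n / real n > 1 - min e 1"
        by (simp_all add: field_simps)
      then show ?case unfolding dist_real_def by linarith
    qed
  qed
qed

definition chebyshev_theta :: "nat \<Rightarrow> real" where
  "chebyshev_theta n = (\<Sum>k=1..n. if prime k then ln (real k) else 0)"

text \<open>Only powers p ^ j with j \<ge> 2 make the difference, and these have p \<le> sqrt n and
  j \<le> log 2 n.\<close>

lemma chebyshev_psi_theta:
  assumes n: "n \<ge> 1"
  shows "\<bar>chebyshev_psi n - chebyshev_theta n\<bar> \<le> (sqrt (real n) + 1) * (log 2 (real n) + 1) * ln (real n)"
proof -
  let ?A = "{k\<in>{1..n}. primepow k \<and> \<not> prime k}"
  have "chebyshev_psi n - chebyshev_theta n = (\<Sum>k=1..n. mangoldt k - (if prime k then ln (real k) else 0))"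
    by (simp add: chebyshev_psi_def chebyshev_theta_def sum_subtractf)
  also have "\<dots> = (\<Sum>k\<in>?A. mangoldt k)"
    by (rule sum.mono_neutral_cong_right) (auto simp: mangoldt_def split: if_splits)
  finally have eq: "chebyshev_psi n - chebyshev_theta n = (\<Sum>k\<in>?A. mangoldt k)" .
  have "(\<Sum>k\<in>?A. mangoldt k) \<le> (\<Sum>k\<in>?A. ln (real n))"
  proof (rule sum_mono)
    fix k assume "k \<in> ?A"
    then have k: "0 < k" "k \<le> n" by auto
    have "mangoldt k \<le> ln (real k)" by (rule mangoldt_le_ln[OF k(1)])
    also have "\<dots> \<le> ln (real n)" using k by simp
    finally show "mangoldt k \<le> ln (real n)" .
  qed
  also have "\<dots> = real (card ?A) * ln (real n)" by simp
  also have "\<dots> \<le> (sqrt (real n) + 1) * (log 2 (real n) + 1) * ln (real n)"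
  proof (rule mult_right_mono)
    let ?S = "nat \<lfloor>sqrt (real n)\<rfloor>" and ?L = "nat \<lfloor>log 2 (real n)\<rfloor>"
    have "?A \<subseteq> (\<lambda>(p, j). p ^ j) ` ({..?S} \<times> {..?L})"
    proof
      fix k assume k: "k \<in> ?A"
      then obtain p j where pj: "prime p" "j > 0" "k = p ^ j" by (auto simp: primepow_def)
      have "j \<noteq> 1" using k pj by auto
      then have j: "j \<ge> 2" using pj by simp
      have p2: "p \<ge> 2" using pj prime_ge_2_nat by blast
      have "p ^ 2 \<le> p ^ j" using j p2 by (intro power_increasing) auto
      also have "\<dots> \<le> n" using k pj by auto
      finally have "(real p)\<^sup>2 \<le> real n" by (metis of_nat_le_iff of_nat_power)
      then have "real p \<le> sqrt (real n)" using real_le_rsqrt by blast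
      then have "p \<le> ?S" by (simp add: le_nat_floor)
      have "2 ^ j \<le> p ^ j" using p2 by (intro power_mono) auto
      also have "\<dots> \<le> n" using k pj by auto
      finally have "2 ^ j \<le> real n" by (metis of_nat_le_iff of_nat_numeral of_nat_power)
      then have "real j \<le> log 2 (real n)" by (rule le_log_of_power) simp
      then have "j \<le> ?L" by (simp add: le_nat_floor)
      then show "k \<in> (\<lambda>(p, j). p ^ j) ` ({..?S} \<times> {..?L})" using \<open>p \<le> ?S\<close> pj by force
    qed
    then have "card ?A \<le> card ({..?S} \<times> {..?L})"
      using card_mono card_image_le by (meson finite_SigmaI finite_atMost finite_imageI order_trans)
    then have "real (card ?A) \<le> real (Suc ?S) * real (Suc ?L)"
      by (metis card_atMost card_cartesian_product of_nat_le_iff of_nat_mult)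
    also have "\<dots> \<le> (sqrt (real n) + 1) * (log 2 (real n) + 1)"
    proof (rule mult_mono)
      show "real (Suc ?S) \<le> sqrt (real n) + 1" by (simp add: of_nat_floor)
      show "real (Suc ?L) \<le> log 2 (real n) + 1" using n by (simp add: of_nat_floor)
    qed (use n in auto)
    finally show "real (card ?A) \<le> (sqrt (real n) + 1) * (log 2 (real n) + 1)" .
  qed (use n in auto)
  finally have "(\<Sum>k\<in>?A. mangoldt k) \<le> (sqrt (real n) + 1) * (log 2 (real n) + 1) * ln (real n)" .
  moreover have "(\<Sum>k\<in>?A. mangoldt k :: real) \<ge> 0" by (intro sum_nonneg mangoldt_nonneg)
  ultimately show ?thesis unfolding eq by simp
qed

theorem chebyshev_theta_asymptotic: "(\<lambda>n. chebyshev_theta n / real n) \<longlonglongrightarrow> 1"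
proof -
  have "(\<lambda>n. chebyshev_psi n / real n) \<longlonglongrightarrow> 1"
    by (rule tendsto_1_of_summable_mono[OF chebyshev_psi_mono summable_psi_minus_id])
  moreover have "(\<lambda>n. (chebyshev_psi n - chebyshev_theta n) / real n) \<longlonglongrightarrow> 0"
  proof (rule Lim_null_comparison)
    show "\<forall>\<^sub>F n in sequentially. norm ((chebyshev_psi n - chebyshev_theta n) / real n)
        \<le> (sqrt (real n) + 1) * (log 2 (real n) + 1) * ln (real n) / real n"
      using eventually_ge_at_top[of 1]
      by eventually_elim (use chebyshev_psi_theta in \<open>auto intro!: divide_right_mono\<close>)
    show "(\<lambda>n. (sqrt (real n) + 1) * (log 2 (real n) + 1) * ln (real n) / real n) \<longlonglongrightarrow> 0"
      by real_asymp
  qed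
  ultimately have "(\<lambda>n. chebyshev_psi n / real n - (chebyshev_psi n - chebyshev_theta n) / real n) \<longlonglongrightarrow> 1 - 0"
    by (rule tendsto_diff)
  then show ?thesis by (simp add: diff_divide_distrib)
qed

section \<open>The generating function near its singularity\<close>

definition neg_log_kernel :: "real \<Rightarrow> real" where
  "neg_log_kernel u = - ln (1 - exp (- u))"

text \<open>The term for \<open>k = 0\<close> vanishes because \<open>x / 0 = 0\<close>.\<close>
lemma neg_log_kernel_sums:
  assumes u: "u > 0"
  shows "(\<lambda>k. exp (- (real k * u)) / real k) sums neg_log_kernel u"
proof -
  have "\<bar>- exp (- u)\<bar> < 1" using u by simp
  from sums_minus[OF ln_series'[OF this]]
  have "(\<lambda>k. exp (- u) ^ k / real k) sums neg_log_kernel u"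
    by (simp add: neg_log_kernel_def)
  then show ?thesis by (simp add: exp_of_nat_mult[symmetric])
qed

lemma neg_log_kernel_nonneg: "u > 0 \<Longrightarrow> neg_log_kernel u \<ge> 0"
  unfolding neg_log_kernel_def by (simp add: ln_le_zero_iff)

lemma neg_log_kernel_antimono: "0 < u \<Longrightarrow> u \<le> v \<Longrightarrow> neg_log_kernel v \<le> neg_log_kernel u"
  unfolding neg_log_kernel_def by simp

text \<open>Half of the exponential decay is split off while a kernel is kept; this controls the
  primes beyond the cutoff in \<open>prime_log_lower\<close>.\<close>

lemma neg_log_kernel_half:
  assumes u: "u > 0"
  shows "neg_log_kernel u \<le> exp (- u / 2) * neg_log_kernel (u / 2)"
proof (rule sums_le[OF _ neg_log_kernel_sums[OF u] sums_mult[OF neg_log_kernel_sums]])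
  fix k :: nat
  show "exp (- (real k * u)) / real k \<le> exp (- u / 2) * (exp (- (real k * (u / 2))) / real k)"
  proof (cases "k = 0")
    case False
    then have "1 * u \<le> real k * u" using u by (intro mult_right_mono) auto
    then have "exp (- (real k * u)) \<le> exp (- u / 2 + - (real k * (u / 2)))" by simp
    then show ?thesis unfolding exp_add using False by (simp add: divide_right_mono)
  qed simp
qed (use u in simp)

lemma neg_log_kernel_le_ln:
  assumes u: "0 < u" "u \<le> 1"
  shows "neg_log_kernel u \<le> ln (1 / u) + 1"
proof -
  have "exp (- u) \<le> 1 / (1 + u)"
    using exp_ge_add_one_self[of u] u by (simp add: exp_minus field_simps)
  also have "\<dots> \<le> 1 - u / 2" using u by (simp add: field_simps)
  finally have "u / 2 \<le> 1 - exp (- u)" by simp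
  then have "ln (u / 2) \<le> ln (1 - exp (- u))" using u by (intro ln_mono) auto
  moreover have "ln (2::real) \<le> 1" using ln_le_minus_one[of 2] by simp
  ultimately show ?thesis using u by (simp add: neg_log_kernel_def ln_div)
qed

text \<open>This rests on the convention \<open>ln 0 = 0\<close>. It lets series over all naturals
  start at index 0 without an extra case.\<close>

lemma neg_log_kernel_0 [simp]: "neg_log_kernel 0 = 0"
  by (simp add: neg_log_kernel_def)

section \<open>The sum over all integers\<close>

lemma sum_le_sums:
  fixes f :: "nat \<Rightarrow> real"
  assumes "f sums s" "finite I" "\<And>n. f n \<ge> 0"
  shows "sum f I \<le> s"
  using sum_le_suminf[of f I] assms by (auto simp: sums_iff)

lemma sum_exp_geometric:
  assumes "t > 0"
  shows "(\<lambda>n. exp (- (real (Suc n) * t))) sums (1 / (exp t - 1))"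
proof -
  have "(\<lambda>n. exp (- t) * exp (- t) ^ n) sums (exp (- t) * (1 / (1 - exp (- t))))"
    by (intro sums_mult geometric_sums) (use assms in simp)
  moreover have "exp (- t) * (1 / (1 - exp (- t))) = 1 / (exp t - 1)"
    using assms by (simp add: exp_minus field_simps)
  moreover have "exp (- t) * exp (- t) ^ n = exp (- (real (Suc n) * t))" for n
    by (simp add: exp_of_nat_mult[symmetric] exp_add[symmetric] algebra_simps)
  ultimately show ?thesis by simp
qed

lemma inverse_squares_sums': "(\<lambda>k. 1 / (real k)\<^sup>2) sums (pi\<^sup>2 / 6)"
  using inverse_squares_sums by (subst sums_Suc_iff[where f = "\<lambda>k. 1 / (real k)\<^sup>2", simplified, symmetric]) (simp add: add.commute)

text \<open>Expanding the kernel and summing over n first bounds the k-th part by 1 / (k (exp (k t)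
  - 1)) \<le> 1 / (k^2 t). With \<open>N\<close> finite, no two infinite sums have to be
  interchanged.\<close>

lemma sum_neg_log_kernel_le:
  assumes t: "t > 0"
  shows "(\<Sum>n<N. neg_log_kernel (real (Suc n) * t)) \<le> pi\<^sup>2 / (6 * t)"
proof -
  have "(\<lambda>k. \<Sum>n<N. exp (- (real k * (real (Suc n) * t))) / real k) sums (\<Sum>n<N. neg_log_kernel (real (Suc n) * t))"
    by (intro sums_sum neg_log_kernel_sums) (use t in simp)
  moreover have "(\<lambda>k. 1 / (real k)\<^sup>2 * (1 / t)) sums (pi\<^sup>2 / 6 * (1 / t))"
    by (intro sums_mult2 inverse_squares_sums')
  moreover have "(\<Sum>n<N. exp (- (real k * (real (Suc n) * t))) / real k) \<le> 1 / (real k)\<^sup>2 * (1 / t)" for k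
  proof (cases "k = 0")
    case False
    then have kt: "real k * t > 0" using t by simp
    have "(\<Sum>n<N. exp (- (real (Suc n) * (real k * t)))) \<le> 1 / (exp (real k * t) - 1)"
      using sum_exp_geometric[OF kt] by (intro sum_le_sums[where I = "{..<N}"]) auto
    also have "\<dots> \<le> 1 / (real k * t)"
    proof (rule divide_left_mono)
      show "real k * t \<le> exp (real k * t) - 1" using exp_ge_add_one_self[of "real k * t"] by linarith
    qed (use kt in auto)
    finally have "(\<Sum>n<N. exp (- (real (Suc n) * (real k * t)))) / real k \<le> 1 / (real k * t) / real k"
      by (intro divide_right_mono) auto
    then show ?thesis by (simp add: sum_divide_distrib power2_eq_square mult_ac)
  qed simp
  ultimately have "(\<Sum>n<N. neg_log_kernel (real (Suc n) * t)) \<le> pi\<^sup>2 / 6 * (1 / t)"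
    by (rule sums_le[rotated])
  then show ?thesis by simp
qed

text \<open>The logarithm of Euler's product for unrestricted partitions at
  \<open>exp (- t)\<close>, to which the primes are compared.\<close>

definition partition_log :: "real \<Rightarrow> real" where
  "partition_log t = (\<Sum>n. neg_log_kernel (real n * t))"

lemma summable_neg_log_kernel:
  assumes t: "t > 0"
  shows "summable (\<lambda>n. neg_log_kernel (real n * t))"
proof -
  have "summable (\<lambda>n. neg_log_kernel (real (Suc n) * t))"
    by (rule bounded_imp_summable[OF _ sum_neg_log_kernel_le[OF t, of "Suc _", unfolded lessThan_Suc_atMost]])
      (use t in \<open>auto intro!: neg_log_kernel_nonneg\<close>)
  then show ?thesis by (subst summable_Suc_iff[symmetric])
qed

text \<open>The upper bound holds for every t > 0. For the lower one finitely many k are kept, since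
  t / (exp (k t) - 1) tends to 1 / k for each fixed k.\<close>

lemma partition_log_asymptotic: "((\<lambda>t. t * partition_log t) \<longlongrightarrow> pi\<^sup>2 / 6) (at_right 0)"
proof (rule order_tendstoI)
  have suc: "(\<lambda>n. neg_log_kernel (real (Suc n) * t)) sums partition_log t" if "t > 0" for t
    using summable_sums[OF summable_neg_log_kernel[OF that]]
    by (subst sums_Suc_iff[where f = "\<lambda>n. neg_log_kernel (real n * t)"]) (simp add: partition_log_def)
  fix a :: real
  show "\<forall>\<^sub>F t in at_right 0. t * partition_log t < a" if a: "pi\<^sup>2 / 6 < a"
    using eventually_at_right_less[of 0]
  proof eventually_elim
    case (elim t)
    have "partition_log t \<le> pi\<^sup>2 / (6 * t)"
      using suc[OF elim] sum_neg_log_kernel_le[OF elim] unfolding sums_def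
      by (intro LIMSEQ_le_const2) auto
    then show ?case using elim a by (simp add: field_simps)
  qed
  assume a: "a < pi\<^sup>2 / 6"
  have "\<forall>\<^sub>F K in sequentially. a < (\<Sum>k<K. 1 / (real k)\<^sup>2)"
    using inverse_squares_sums' a unfolding sums_def by (intro order_tendstoD) auto
  then obtain K where K: "a < (\<Sum>k<K. 1 / (real k)\<^sup>2)" by (auto simp: eventually_sequentially)
  have "((\<lambda>t. \<Sum>k<K. t / (exp (real k * t) - 1) / real k) \<longlongrightarrow> (\<Sum>k<K. 1 / real k / real k)) (at_right 0)"
  proof (intro tendsto_sum)
    fix k
    show "((\<lambda>t. t / (exp (real k * t) - 1) / real k) \<longlongrightarrow> 1 / real k / real k) (at_right 0)"
    proof (cases "k = 0")
      case False
      then have "real k > 0" by simp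
      then show ?thesis by real_asymp (simp add: field_simps)
    qed simp
  qed
  then have "\<forall>\<^sub>F t in at_right 0. a < (\<Sum>k<K. t / (exp (real k * t) - 1) / real k)"
    using K by (intro order_tendstoD) (simp_all add: power2_eq_square)
  then show "\<forall>\<^sub>F t in at_right 0. a < t * partition_log t"
    using eventually_at_right_less[of 0]
  proof eventually_elim
    case (elim t)
    have "(\<Sum>k<K. 1 / (exp (real k * t) - 1) / real k) \<le> partition_log t"
    proof (rule sums_le[OF _ _ suc[OF elim(2)]])
      show "(\<lambda>n. \<Sum>k<K. exp (- (real (Suc n) * (real k * t))) / real k) sums (\<Sum>k<K. 1 / (exp (real k * t) - 1) / real k)"
      proof (intro sums_sum)
        fix k
        show "(\<lambda>n. exp (- (real (Suc n) * (real k * t))) / real k) sums (1 / (exp (real k * t) - 1) / real k)"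
        proof (cases "k = 0")
          case False
          then show ?thesis using elim by (intro sums_divide sum_exp_geometric) auto
        qed simp
      qed
      fix n
      have "(\<Sum>k<K. exp (- (real k * (real (Suc n) * t))) / real k) \<le> neg_log_kernel (real (Suc n) * t)"
        using neg_log_kernel_sums[of "real (Suc n) * t"] elim by (intro sum_le_sums) auto
      then show "(\<Sum>k<K. exp (- (real (Suc n) * (real k * t))) / real k) \<le> neg_log_kernel (real (Suc n) * t)"
        by (simp only: mult_ac)
    qed
    then have "t * (\<Sum>k<K. 1 / (exp (real k * t) - 1) / real k) \<le> t * partition_log t"
      using elim by (intro mult_left_mono) auto
    then show ?case using elim by (simp add: sum_distrib_left)
  qed
qed

section \<open>Primes weighted by ln p\<close>

lemma abel_summation_bound:
  fixes a f :: "nat \<Rightarrow> real"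
  assumes A: "\<And>n. \<bar>(\<Sum>k=1..n. a k) - real n\<bar> \<le> e * real n + C"
    and f: "\<And>n. n \<ge> 1 \<Longrightarrow> f (Suc n) \<le> f n" "\<And>n. n \<ge> 1 \<Longrightarrow> f n \<ge> 0"
  shows "\<bar>\<Sum>n=1..N. (a n - 1) * f n\<bar> \<le> e * (\<Sum>n=1..N. f n) + C * f 1"
proof -
  define D where "D = (\<lambda>n. (\<Sum>k=1..n. a k) - real n)"
  have 1: "(\<Sum>n=1..N. (a n - 1) * f n) = D N * f (Suc N) + (\<Sum>n=1..N. D n * (f n - f (Suc n)))"
  proof (induction N)
    case (Suc N)
    have "a (Suc N) - 1 = D (Suc N) - D N" by (simp add: D_def)
    then have "(\<Sum>n=1..Suc N. (a n - 1) * f n) = (\<Sum>n=1..N. (a n - 1) * f n) + (D (Suc N) - D N) * f (Suc N)"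
      by simp
    then show ?case unfolding Suc.IH by (simp add: algebra_simps)
  qed (simp add: D_def)
  \<comment> \<open>The bound is itself a sum by parts, with \<open>e * n + C\<close> in place of
    \<open>D n\<close>, so the two sides can be compared term by term.\<close>
  have 2: "e * (\<Sum>n=1..N. f n) + C * f 1 = (e * real N + C) * f (Suc N) + (\<Sum>n=1..N. (e * real n + C) * (f n - f (Suc n)))"
    by (induction N) (simp_all add: algebra_simps)
  have "\<bar>\<Sum>n=1..N. (a n - 1) * f n\<bar> \<le> \<bar>D N * f (Suc N)\<bar> + (\<Sum>n=1..N. \<bar>D n * (f n - f (Suc n))\<bar>)"
    unfolding 1 by (rule order_trans[OF abs_triangle_ineq add_left_mono[OF sum_abs]])
  also have "\<dots> \<le> (e * real N + C) * f (Suc N) + (\<Sum>n=1..N. (e * real n + C) * (f n - f (Suc n)))"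
  proof (intro add_mono sum_mono)
    show "\<bar>D N * f (Suc N)\<bar> \<le> (e * real N + C) * f (Suc N)"
      using A[of N] f(2)[of "Suc N"] by (simp add: abs_mult D_def mult_right_mono)
    fix n assume "n \<in> {1..N}"
    then have "f n - f (Suc n) \<ge> 0" using f(1) by simp
    then show "\<bar>D n * (f n - f (Suc n))\<bar> \<le> (e * real n + C) * (f n - f (Suc n))"
      using A[of n] by (simp add: abs_mult D_def mult_right_mono)
  qed
  finally show ?thesis unfolding 2 .
qed

text \<open>With these weights the partial sums are \<open>chebyshev_theta\<close>, so the prime
  number theorem enters directly.\<close>

definition prime_log_weight :: "nat \<Rightarrow> real" where
  "prime_log_weight n = (if prime n then ln (real n) else 0)"

lemma prime_log_weight_nonneg: "prime_log_weight n \<ge> 0"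
  unfolding prime_log_weight_def using prime_ge_1_nat[of n] by auto

definition weighted_log :: "real \<Rightarrow> real" where
  "weighted_log t = (\<Sum>n. prime_log_weight n * neg_log_kernel (real n * t))"

text \<open>The constant absorbs the finitely many n before the asymptotics set in, giving the error
  shape that \<open>abel_summation_bound\<close> takes.\<close>

lemma chebyshev_theta_close:
  assumes e: "e > 0"
  obtains C where "\<And>n. \<bar>(\<Sum>k=1..n. prime_log_weight k) - real n\<bar> \<le> e * real n + C" "C \<ge> 0"
proof -
  have th: "(\<Sum>k=1..n. prime_log_weight k) = chebyshev_theta n" for n
    by (simp add: chebyshev_theta_def prime_log_weight_def)
  have "\<forall>\<^sub>F n in sequentially. dist (chebyshev_theta n / real n) 1 < e"
    using chebyshev_theta_asymptotic e by (rule tendstoD)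
  then obtain N where N: "\<And>n. n \<ge> N \<Longrightarrow> dist (chebyshev_theta n / real n) 1 < e"
    by (auto simp: eventually_sequentially)
  define C where "C = Max ((\<lambda>n. \<bar>chebyshev_theta n - real n\<bar>) ` {..N})"
  have C: "\<bar>chebyshev_theta n - real n\<bar> \<le> C" if "n \<le> N" for n
    unfolding C_def using that by (intro Max_ge) auto
  have C0: "C \<ge> 0" using order_trans[OF abs_ge_zero C[of 0]] by simp
  have "\<bar>chebyshev_theta n - real n\<bar> \<le> e * real n + C" for n
  proof (cases "n \<le> N")
    case True
    then show ?thesis using C[OF True] e by (simp add: add_increasing)
  next
    case False
    then have n: "real n > 0" by simp
    have "\<bar>chebyshev_theta n / real n - 1\<bar> < e" using N[of n] False by (simp add: dist_real_def)
    then have "\<bar>chebyshev_theta n / real n - 1\<bar> * real n \<le> e * real n" using n by (intro mult_right_mono) auto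
    also have "\<bar>chebyshev_theta n / real n - 1\<bar> * real n = \<bar>(chebyshev_theta n / real n - 1) * real n\<bar>"
      using n by (simp add: abs_mult)
    also have "(chebyshev_theta n / real n - 1) * real n = chebyshev_theta n - real n"
      using n by (simp add: field_simps)
    finally show ?thesis using C0 by simp
  qed
  then show thesis using that C0 unfolding th by blast
qed

lemma sum_1_eq_lessThan: "f 0 = 0 \<Longrightarrow> (\<Sum>n=1..N. f n) = (\<Sum>n<Suc N. f n :: real)"
  by (subst lessThan_Suc_atMost, subst atMost_atLeast0, subst sum.atLeast_Suc_atMost) auto

lemma
  assumes t: "t > 0"
  shows weighted_log_sums: "(\<lambda>n. prime_log_weight n * neg_log_kernel (real n * t)) sums weighted_log t"
    and weighted_log_close: "\<And>e C. (\<And>n. \<bar>(\<Sum>k=1..n. prime_log_weight k) - real n\<bar> \<le> e * real n + C) \<Longrightarrow>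
      \<bar>weighted_log t - partition_log t\<bar> \<le> e * partition_log t + C * neg_log_kernel t"
proof -
  let ?f = "\<lambda>n. neg_log_kernel (real n * t)"
  have f0: "?f n \<ge> 0" for n using neg_log_kernel_nonneg[of "real n * t"] t by (cases "n = 0") auto
  have f: "?f (Suc n) \<le> ?f n" if "n \<ge> 1" for n
    using that t by (intro neg_log_kernel_antimono) auto
  have P: "?f sums partition_log t"
    unfolding partition_log_def by (rule summable_sums[OF summable_neg_log_kernel[OF t]])
  have fin: "\<bar>(\<Sum>n<Suc N. prime_log_weight n * ?f n) - (\<Sum>n<Suc N. ?f n)\<bar> \<le> e * (\<Sum>n<Suc N. ?f n) + C * ?f 1"
    if A: "\<And>n. \<bar>(\<Sum>k=1..n. prime_log_weight k) - real n\<bar> \<le> e * real n + C" for e C N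
  proof -
    have "(\<Sum>n<Suc N. prime_log_weight n * ?f n) - (\<Sum>n<Suc N. ?f n) = (\<Sum>n<Suc N. (prime_log_weight n - 1) * ?f n)"
      unfolding left_diff_distrib sum_subtractf mult_1_left ..
    also have "\<dots> = (\<Sum>n=1..N. (prime_log_weight n - 1) * ?f n)"
      by (rule sum_1_eq_lessThan[symmetric]) simp
    also have "\<bar>\<dots>\<bar> \<le> e * (\<Sum>n=1..N. ?f n) + C * ?f 1"
      using abel_summation_bound[OF A, of ?f N] f f0 by blast
    also have "(\<Sum>n=1..N. ?f n) = (\<Sum>n<Suc N. ?f n)"
      by (rule sum_1_eq_lessThan) simp
    finally show ?thesis .
  qed
  \<comment> \<open>The crude choice \<open>e = 1\<close> already bounds the partial sums, hence
    gives summability.\<close>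
  obtain C where C: "\<And>n. \<bar>(\<Sum>k=1..n. prime_log_weight k) - real n\<bar> \<le> 1 * real n + C" "C \<ge> 0"
    by (rule chebyshev_theta_close[of 1]) (simp, rule that)
  have "summable (\<lambda>n. prime_log_weight n * ?f n)"
  proof (rule bounded_imp_summable)
    show "prime_log_weight n * ?f n \<ge> 0" for n using f0 prime_log_weight_nonneg by simp
    fix N
    have "(\<Sum>n<Suc N. ?f n) \<le> partition_log t" by (rule sum_le_sums[OF P]) (use f0 in auto)
    then show "(\<Sum>n\<le>N. prime_log_weight n * ?f n) \<le> 2 * partition_log t + C * ?f 1"
      using fin[OF C(1), of N] unfolding lessThan_Suc_atMost by simp
  qed
  then show L: "(\<lambda>n. prime_log_weight n * ?f n) sums weighted_log t"
    unfolding weighted_log_def by (rule summable_sums)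
  fix e C
  assume A: "\<And>n. \<bar>(\<Sum>k=1..n. prime_log_weight k) - real n\<bar> \<le> e * real n + C"
  have "(\<lambda>N. \<bar>(\<Sum>n<Suc N. prime_log_weight n * ?f n) - (\<Sum>n<Suc N. ?f n)\<bar>) \<longlonglongrightarrow> \<bar>weighted_log t - partition_log t\<bar>"
    using L P unfolding sums_def by (intro tendsto_intros LIMSEQ_Suc)
  moreover have "(\<lambda>N. e * (\<Sum>n<Suc N. ?f n) + C * ?f 1) \<longlonglongrightarrow> e * partition_log t + C * ?f 1"
    using P unfolding sums_def by (intro tendsto_intros LIMSEQ_Suc)
  ultimately have "\<bar>weighted_log t - partition_log t\<bar> \<le> e * partition_log t + C * ?f 1"
    by (rule LIMSEQ_le) (use fin[OF A] in blast)
  then show "\<bar>weighted_log t - partition_log t\<bar> \<le> e * partition_log t + C * neg_log_kernel t" by simp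
qed

lemma weighted_log_asymptotic: "((\<lambda>t. t * weighted_log t) \<longlongrightarrow> pi\<^sup>2 / 6) (at_right 0)"
proof -
  have "((\<lambda>t. t * weighted_log t - t * partition_log t) \<longlongrightarrow> 0) (at_right 0)"
  proof (rule tendstoI)
    fix r :: real assume r: "r > 0"
    \<comment> \<open>As pi^2 / 6 < 3, the main error is at most 3 e = r / 2. The other half is left
      for the constant \<open>C\<close>, whose term vanishes because the kernel at t grows only
      logarithmically.\<close>
    define e where "e = r / 6"
    have e: "e > 0" using r by (simp add: e_def)
    obtain C where C: "\<And>n. \<bar>(\<Sum>k=1..n. prime_log_weight k) - real n\<bar> \<le> e * real n + C" "C \<ge> 0"
      by (rule chebyshev_theta_close[OF e]) (rule that)
    have pi: "pi\<^sup>2 / 6 < 3"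
    proof -
      have "pi * pi < 4 * 4" using pi_less_4 pi_gt_zero by (intro mult_strict_mono) auto
      then show ?thesis by (simp add: power2_eq_square)
    qed
    have "\<forall>\<^sub>F t in at_right 0. t * partition_log t < 3"
      using partition_log_asymptotic pi by (rule order_tendstoD)
    moreover have "((\<lambda>t::real. C * (t * (ln (1 / t) + 1))) \<longlongrightarrow> C * 0) (at_right 0)"
      by (intro tendsto_mult tendsto_const) real_asymp
    then have "\<forall>\<^sub>F t::real in at_right 0. C * (t * (ln (1 / t) + 1)) < r / 2"
      using r by (intro order_tendstoD) auto
    moreover have "\<forall>\<^sub>F t::real in at_right 0. t < 1" by (rule eventually_at_right_real[of 0 1, THEN eventually_mono]) auto
    ultimately show "\<forall>\<^sub>F t in at_right 0. dist (t * weighted_log t - t * partition_log t) 0 < r"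
      using eventually_at_right_less[of 0]
    proof eventually_elim
      case (elim t)
      have "\<bar>t * weighted_log t - t * partition_log t\<bar> = t * \<bar>weighted_log t - partition_log t\<bar>"
        using elim by (simp add: abs_mult right_diff_distrib[symmetric])
      also have "\<dots> \<le> t * (e * partition_log t + C * neg_log_kernel t)"
        using elim by (intro mult_left_mono weighted_log_close C(1)) auto
      also have "\<dots> = e * (t * partition_log t) + C * (t * neg_log_kernel t)" by (simp add: algebra_simps)
      also have "\<dots> \<le> e * 3 + C * (t * (ln (1 / t) + 1))"
        using elim e C(2) neg_log_kernel_le_ln[of t] by (intro add_mono mult_left_mono) auto
      also have "\<dots> < r" using elim by (simp add: e_def)
      finally show ?case by (simp add: dist_real_def)
    qed
  qed
  from tendsto_add[OF this partition_log_asymptotic] show ?thesis by simp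
qed

section \<open>Removing the weights ln p\<close>

definition prime_log :: "real \<Rightarrow> real" where
  "prime_log t = (\<Sum>n. if prime n then neg_log_kernel (real n * t) else 0)"

lemma neg_log_kernel_nat_nonneg: "t > 0 \<Longrightarrow> neg_log_kernel (real n * t) \<ge> 0"
  using neg_log_kernel_nonneg[of "real n * t"] by (cases "n = 0") auto

lemma prime_log_sums:
  assumes t: "t > 0"
  shows "(\<lambda>n. if prime n then neg_log_kernel (real n * t) else 0) sums prime_log t"
  unfolding prime_log_def
  by (rule summable_sums, rule summable_comparison_test'[OF summable_neg_log_kernel[OF t]])
    (use neg_log_kernel_nat_nonneg[OF t] in auto)

text \<open>Primes up to y are counted trivially, each contributing at most
  \<open>neg_log_kernel t\<close>; beyond y the weight ln n / ln y is at least 1.\<close>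

lemma prime_log_upper:
  assumes t: "t > 0" and y: "y > 1"
  shows "prime_log t \<le> y * neg_log_kernel t + weighted_log t / ln y"
proof -
  let ?Y = "nat \<lfloor>y\<rfloor>"
  let ?g = "\<lambda>n. if n \<in> {1..?Y} then neg_log_kernel t else 0"
  have "?g sums (\<Sum>n\<in>{1..?Y}. neg_log_kernel t)"
    by (rule sums_If_finite_set) simp
  from sums_add[OF this sums_divide[OF weighted_log_sums[OF t], of "ln y"]]
  have S: "(\<lambda>n. ?g n + prime_log_weight n * neg_log_kernel (real n * t) / ln y) sums (real ?Y * neg_log_kernel t + weighted_log t / ln y)"
    by simp
  have "prime_log t \<le> real ?Y * neg_log_kernel t + weighted_log t / ln y"
  proof (rule sums_le[OF _ prime_log_sums[OF t] S])
    fix n :: nat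
    let ?f = "neg_log_kernel (real n * t)"
    have f0: "?f \<ge> 0" by (rule neg_log_kernel_nat_nonneg[OF t])
    have w: "prime_log_weight n * ?f / ln y \<ge> 0" using f0 prime_log_weight_nonneg[of n] y by simp
    show "(if prime n then ?f else 0) \<le> ?g n + prime_log_weight n * ?f / ln y"
    proof (cases "prime n")
      case True
      then have n1: "n \<ge> 1" using prime_ge_1_nat by blast
      show ?thesis
      proof (cases "n \<le> ?Y")
        case le: True
        have "1 * t \<le> real n * t" using n1 t by (intro mult_right_mono) auto
        then have "?f \<le> neg_log_kernel t" using t by (intro neg_log_kernel_antimono) auto
        then show ?thesis using w n1 le True by simp
      next
        case False
        then have "y < real n" using y by linarith
        then have "1 * ?f \<le> ln (real n) / ln y * ?f"
          using y f0 by (intro mult_right_mono) auto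
        then show ?thesis using True False by (simp add: prime_log_weight_def)
      qed
    next
      case False
      then show ?thesis using w neg_log_kernel_nonneg[OF t] by auto
    qed
  qed
  also have "\<dots> \<le> y * neg_log_kernel t + weighted_log t / ln y"
    using y neg_log_kernel_nonneg[OF t] by (intro add_mono mult_right_mono) auto
  finally show ?thesis .
qed

text \<open>Up to y the weight is at most ln y. Beyond y it is kept, and
  \<open>neg_log_kernel_half\<close> supplies the small factor at the price of passing to t /
  2.\<close>

lemma prime_log_lower:
  assumes t: "t > 0" and y: "y > 1"
  shows "weighted_log t \<le> ln y * prime_log t + exp (- (y * t) / 2) * weighted_log (t / 2)"
proof (rule sums_le[OF _ weighted_log_sums[OF t] sums_add[OF sums_mult[OF prime_log_sums[OF t]] sums_mult[OF weighted_log_sums]]])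
  fix n :: nat
  let ?f = "\<lambda>t. neg_log_kernel (real n * t)"
  have f0: "?f t \<ge> 0" "?f (t / 2) \<ge> 0" using neg_log_kernel_nat_nonneg[of t n] neg_log_kernel_nat_nonneg[of "t / 2" n] t by auto
  show "prime_log_weight n * ?f t \<le> ln y * (if prime n then ?f t else 0) + exp (- (y * t) / 2) * (prime_log_weight n * ?f (t / 2))"
  proof (cases "prime n")
    case True
    then have n: "real n > 0" using prime_gt_0_nat by simp
    then have w: "prime_log_weight n = ln (real n)" "ln (real n) \<ge> 0" using True by (auto simp: prime_log_weight_def)
    show ?thesis
    proof (cases "real n \<le> y")
      case le: True
      then have "ln (real n) * ?f t \<le> ln y * ?f t" using n f0 by (intro mult_right_mono) auto
      then show ?thesis using True w f0 by (simp add: add_increasing2)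
    next
      case False
      have "?f t \<le> exp (- (real n * t) / 2) * neg_log_kernel (real n * t / 2)"
        using neg_log_kernel_half[of "real n * t"] n t by simp
      also have "\<dots> \<le> exp (- (y * t) / 2) * neg_log_kernel (real n * t / 2)"
        using False t f0 by (intro mult_right_mono) auto
      finally have "ln (real n) * ?f t \<le> ln (real n) * (exp (- (y * t) / 2) * ?f (t / 2))"
        using w by (intro mult_left_mono) auto
      moreover have "ln y * ?f t \<ge> 0" using y f0 by simp
      ultimately show ?thesis using True w by (simp add: mult_ac)
    qed
  qed (simp add: prime_log_weight_def)
qed (use t in simp)

theorem prime_log_asymptotic: "((\<lambda>t. t * ln (1 / t) * prime_log t) \<longlongrightarrow> pi\<^sup>2 / 6) (at_right 0)"
proof (rule tendsto_sandwich)
  let ?l = "\<lambda>t::real. ln (1 / t)"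
  \<comment> \<open>The lower estimate takes y = ln (1 / t) / t, which makes exp (- y t / 2) equal
    to sqrt t. The upper one takes y = 1 / (t ln (1 / t)^3), so small that the trivial count is
    negligible. In both cases ln y is asymptotic to ln (1 / t).\<close>
  let ?lo = "\<lambda>t. ?l t / ln (?l t / t) * (t * weighted_log t - exp (- ?l t / 2) * 2 * (t / 2 * weighted_log (t / 2)))"
  let ?up = "\<lambda>t. t * ?l t * (1 / (t * ?l t ^ 3)) * (?l t + 1) + ?l t / ln (1 / (t * ?l t ^ 3)) * (t * weighted_log t)"
  have half: "filterlim (\<lambda>t::real. t / 2) (at_right 0) (at_right 0)" by real_asymp
  have "(?lo \<longlongrightarrow> 1 * (pi\<^sup>2 / 6 - 0 * (pi\<^sup>2 / 6))) (at_right 0)"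
  proof (intro tendsto_mult tendsto_diff weighted_log_asymptotic filterlim_compose[OF weighted_log_asymptotic half])
    show "((\<lambda>t. ?l t / ln (?l t / t)) \<longlongrightarrow> 1) (at_right 0)" by real_asymp
    show "((\<lambda>t. exp (- ?l t / 2) * 2) \<longlongrightarrow> 0) (at_right 0)" by real_asymp
  qed
  then show "(?lo \<longlongrightarrow> pi\<^sup>2 / 6) (at_right 0)" by simp
  have "(?up \<longlongrightarrow> 0 + 1 * (pi\<^sup>2 / 6)) (at_right 0)"
  proof (intro tendsto_mult[OF _ weighted_log_asymptotic] tendsto_add)
    show "((\<lambda>t. t * ?l t * (1 / (t * ?l t ^ 3)) * (?l t + 1)) \<longlongrightarrow> 0) (at_right 0)" by real_asymp
    show "((\<lambda>t. ?l t / ln (1 / (t * ?l t ^ 3))) \<longlongrightarrow> 1) (at_right 0)" by real_asymp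
  qed
  then show "(?up \<longlongrightarrow> pi\<^sup>2 / 6) (at_right 0)" by simp
  have ev: "\<forall>\<^sub>F t::real in at_right 0. ?l t > 0" "\<forall>\<^sub>F t::real in at_right 0. ?l t / t > 1"
    "\<forall>\<^sub>F t::real in at_right 0. 1 / (t * ?l t ^ 3) > 1" "\<forall>\<^sub>F t::real in at_right 0. t < 1"
    by real_asymp+
  show "\<forall>\<^sub>F t in at_right 0. ?lo t \<le> t * ?l t * prime_log t"
    using ev eventually_at_right_less[of 0]
  proof eventually_elim
    case (elim t)
    have "weighted_log t - exp (- ?l t / 2) * weighted_log (t / 2) \<le> ln (?l t / t) * prime_log t"
      using prime_log_lower[of t "?l t / t"] elim by simp
    then have "?l t / ln (?l t / t) * t * (weighted_log t - exp (- ?l t / 2) * weighted_log (t / 2))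
        \<le> ?l t / ln (?l t / t) * t * (ln (?l t / t) * prime_log t)"
      using elim by (intro mult_left_mono) auto
    also have "\<dots> = t * ?l t * prime_log t" using ln_gt_zero[OF elim(2)] by simp
    also have "?l t / ln (?l t / t) * t * (weighted_log t - exp (- ?l t / 2) * weighted_log (t / 2)) = ?lo t"
      by (simp add: right_diff_distrib mult_ac)
    finally show ?case .
  qed
  show "\<forall>\<^sub>F t in at_right 0. t * ?l t * prime_log t \<le> ?up t"
    using ev eventually_at_right_less[of 0]
  proof eventually_elim
    case (elim t)
    let ?y = "1 / (t * ?l t ^ 3)"
    have "prime_log t \<le> ?y * neg_log_kernel t + weighted_log t / ln ?y"
      by (rule prime_log_upper) (use elim in auto)
    also have "\<dots> \<le> ?y * (?l t + 1) + weighted_log t / ln ?y"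
      using neg_log_kernel_le_ln[of t] elim by (intro add_mono mult_left_mono) auto
    finally have "t * ?l t * prime_log t \<le> t * ?l t * (?y * (?l t + 1) + weighted_log t / ln ?y)"
      using elim by (intro mult_left_mono) auto
    also have "\<dots> = ?up t" by (simp only: distrib_left times_divide_eq_right times_divide_eq_left mult_ac)
    finally show ?case .
  qed
qed

section \<open>Partitions into primes\<close>

text \<open>The set of admissible parts is a parameter so that the product formula can be proved by
  induction over finite sets of primes.\<close>

definition partitions_into :: "nat set \<Rightarrow> nat \<Rightarrow> nat list set" where
  "partitions_into P n = {as. sorted as \<and> set as \<subseteq> P \<and> sum_list as = n}"

lemma partitions_into_subset: "P \<subseteq> {p. prime p} \<Longrightarrow> partitions_into P n \<subseteq> prime_partitions n"
  by (auto simp: partitions_into_def prime_partitions_def)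

lemma finite_partitions_into: "P \<subseteq> {p. prime p} \<Longrightarrow> finite (partitions_into P n)"
  by (rule finite_subset[OF partitions_into_subset finite_prime_partitions])

lemma partitions_into_bounded:
  assumes "n \<le> N"
  shows "partitions_into {p. prime p \<and> p \<le> N} n = prime_partitions n"
proof -
  have "a \<le> N" if "sum_list as = n" "a \<in> set as" for a as
    using member_le_sum_list[OF that(2)] that(1) assms by simp
  then show ?thesis by (auto simp: partitions_into_def prime_partitions_def)
qed

text \<open>As p is below all of P, a sorted list containing p must begin with it, and deleting the
  head leaves a partition of n - p.\<close>

lemma partitions_into_insert:
  assumes less: "\<And>a. a \<in> P \<Longrightarrow> p < a"
  shows "partitions_into (insert p P) n =
    partitions_into P n \<union> (if p \<le> n then (#) p ` partitions_into (insert p P) (n - p) else {})"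
proof (intro equalityI subsetI)
  fix as assume as: "as \<in> partitions_into (insert p P) n"
  show "as \<in> partitions_into P n \<union> (if p \<le> n then (#) p ` partitions_into (insert p P) (n - p) else {})"
  proof (cases "p \<in> set as")
    case False
    then show ?thesis using as by (auto simp: partitions_into_def)
  next
    case True
    then obtain a bs where ab: "as = a # bs" by (cases as) auto
    have "a \<le> p" using True as ab by (auto simp: partitions_into_def)
    moreover have "a \<in> insert p P" using as ab by (auto simp: partitions_into_def)
    ultimately have "a = p" using less by force
    then show ?thesis using as ab by (auto simp: partitions_into_def)
  qed
next
  fix as assume "as \<in> partitions_into P n \<union> (if p \<le> n then (#) p ` partitions_into (insert p P) (n - p) else {})"
  then show "as \<in> partitions_into (insert p P) n"
  proof
    assume "as \<in> partitions_into P n"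
    then show ?thesis by (auto simp: partitions_into_def)
  next
    assume "as \<in> (if p \<le> n then (#) p ` partitions_into (insert p P) (n - p) else {})"
    then obtain bs where "p \<le> n" "as = p # bs" "bs \<in> partitions_into (insert p P) (n - p)"
      by (auto split: if_splits)
    then show ?thesis using less by (fastforce simp: partitions_into_def)
  qed
qed

lemma card_partitions_into_insert:
  assumes less: "\<And>a. a \<in> P \<Longrightarrow> p < a" and P: "insert p P \<subseteq> {p. prime p}"
  shows "card (partitions_into (insert p P) n) =
    card (partitions_into P n) + (if p \<le> n then card (partitions_into (insert p P) (n - p)) else 0)"
proof (cases "p \<le> n")
  case True
  have eq: "partitions_into (insert p P) n = partitions_into P n \<union> (#) p ` partitions_into (insert p P) (n - p)"
    using partitions_into_insert[OF less, where n = n] True by simp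
  have "card (partitions_into P n \<union> (#) p ` partitions_into (insert p P) (n - p))
      = card (partitions_into P n) + card ((#) p ` partitions_into (insert p P) (n - p))"
  proof (rule card_Un_disjoint)
    have "p \<notin> P" using less by blast
    then have "p # bs \<notin> partitions_into P n" for bs by (simp add: partitions_into_def)
    then show "partitions_into P n \<inter> (#) p ` partitions_into (insert p P) (n - p) = {}" by blast
    show "finite (partitions_into P n)" by (rule finite_partitions_into) (use P in blast)
    show "finite ((#) p ` partitions_into (insert p P) (n - p))"
      by (rule finite_imageI, rule finite_partitions_into, rule P)
  qed
  also have "card ((#) p ` partitions_into (insert p P) (n - p)) = card (partitions_into (insert p P) (n - p))"
    by (rule card_image) (auto intro: inj_onI)
  finally show ?thesis unfolding eq[symmetric] using True by simp
next
  case False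
  then show ?thesis using partitions_into_insert[OF less, where n = n] by simp
qed

text \<open>This is division of a power series by 1 - x ^ p, with \<open>c\<close> for x ^ p and the
  powers of x absorbed into \<open>f\<close> and \<open>g\<close>. Convergence comes first: each
  partial sum of \<open>f\<close> times 1 - c is at most S. Only then can the recurrence be
  summed.\<close>

lemma sums_of_recurrence:
  fixes f g :: "nat \<Rightarrow> real"
  assumes g: "g sums S" and f0: "\<And>n. f n \<ge> 0" and c: "0 \<le> c" "c < 1"
    and rec: "\<And>n. f n = g n + (if p \<le> n then c * f (n - p) else 0)" and g0: "\<And>n. g n \<ge> 0"
  shows "f sums (S * (1 / (1 - c)))"
proof -
  define h where "h = (\<lambda>n. if p \<le> n then c * f (n - p) else 0)"
  have h_eq: "(\<Sum>n<N + p. h n) = c * (\<Sum>n<N. f n)" for N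
    by (induction N) (simp_all add: h_def distrib_left)
  have "summable f"
  proof (rule bounded_imp_summable[OF f0])
    fix N
    have "(\<Sum>n<Suc N. f n) = (\<Sum>n<Suc N. g n) + (\<Sum>n<Suc N. h n)"
      unfolding h_def sum.distrib[symmetric] by (rule sum.cong[OF refl rec])
    also have "(\<Sum>n<Suc N. g n) \<le> S" by (rule sum_le_sums[OF g _ g0]) simp
    also have "(\<Sum>n<Suc N. h n) \<le> (\<Sum>n<Suc N + p. h n)"
      by (rule sum_mono2) (use f0 c in \<open>auto simp: h_def\<close>)
    also have "\<dots> = c * (\<Sum>n<Suc N. f n)" by (rule h_eq)
    finally have "(1 - c) * (\<Sum>n<Suc N. f n) \<le> S" by (simp add: left_diff_distrib)
    then show "(\<Sum>n\<le>N. f n) \<le> S / (1 - c)"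
      using c unfolding lessThan_Suc_atMost by (simp add: field_simps)
  qed
  then have f: "f sums suminf f" by (rule summable_sums)
  have "(\<lambda>n. h (n + p)) sums (c * suminf f)"
    using sums_mult[OF f, of c] by (simp add: h_def)
  then have "h sums (c * suminf f + (\<Sum>i<p. h i))" by (subst (asm) sums_iff_shift)
  then have "h sums (c * suminf f)" by (simp add: h_def)
  from sums_add[OF g this] have "f sums (S + c * suminf f)"
    unfolding h_def rec[symmetric] .
  then have "suminf f = S + c * suminf f" using f sums_unique2 by blast
  then have "suminf f * (1 - c) = S" by (simp add: algebra_simps)
  then have "suminf f = S * (1 / (1 - c))" using c by (simp add: field_simps)
  then show ?thesis using f by simp
qed

text \<open>The induction inserts elements below all earlier ones, as
  \<open>card_partitions_into_insert\<close> requires.\<close>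

lemma partitions_into_sums:
  fixes x :: real
  assumes "finite P" "P \<subseteq> {p. prime p}" and x: "0 < x" "x < 1"
  shows "(\<lambda>n. real (card (partitions_into P n)) * x ^ n) sums (\<Prod>p\<in>P. 1 / (1 - x ^ p))"
  using assms(1,2)
proof (induction P rule: finite_linorder_min_induct)
  case empty
  have "partitions_into {} n = (if n = 0 then {[]} else {})" for n
    by (auto simp: partitions_into_def)
  then have "(\<lambda>n. real (card (partitions_into {} n)) * x ^ n) = (\<lambda>n. if n = 0 then 1 else 0)"
    by auto
  then show ?case using sums_single[of 0 "\<lambda>_. 1 :: real"] by simp
next
  case (insert p P)
  have p: "prime p" using insert.prems by simp
  then have p0: "p > 0" by (rule prime_gt_0_nat)
  have xp: "x ^ p < 1" "0 \<le> x ^ p" using x p0 by (auto simp: power_less_one_iff)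
  have S: "(\<lambda>n. real (card (partitions_into P n)) * x ^ n) sums (\<Prod>p\<in>P. 1 / (1 - x ^ p))"
    using insert by simp
  have "(\<lambda>n. real (card (partitions_into (insert p P) n)) * x ^ n) sums ((\<Prod>p\<in>P. 1 / (1 - x ^ p)) * (1 / (1 - x ^ p)))"
  proof (rule sums_of_recurrence[OF S])
    fix n
    have "real (card (partitions_into (insert p P) n)) * x ^ n = real (card (partitions_into P n)) * x ^ n
       + (if p \<le> n then real (card (partitions_into (insert p P) (n - p))) * x ^ n else 0)"
      using insert.hyps insert.prems by (subst card_partitions_into_insert) (auto simp: algebra_simps)
    moreover have "x ^ n = x ^ p * x ^ (n - p)" if "p \<le> n" using that by (simp add: power_add[symmetric])
    ultimately show "real (card (partitions_into (insert p P) n)) * x ^ n = real (card (partitions_into P n)) * x ^ n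
       + (if p \<le> n then x ^ p * (real (card (partitions_into (insert p P) (n - p))) * x ^ (n - p)) else 0)"
      by (auto simp: mult_ac)
  qed (use x xp in auto)
  moreover have "p \<notin> P" using insert.hyps by auto
  ultimately show ?case using insert.hyps by (simp add: mult.commute)
qed

text \<open>With parts at most N the product is finite. Its series agrees with that of
  \<open>pp\<close> up to index N, which bounds the partial sums, and lies below it termwise, which
  gives the reverse inequality as N grows.\<close>

theorem pp_sums:
  assumes t: "t > 0"
  shows "(\<lambda>n. real (pp n) * exp (- (real n * t))) sums exp (prime_log t)"
proof -
  define x where "x = exp (- t)"
  have x: "0 < x" "x < 1" using t by (auto simp: x_def)
  have xn: "exp (- (real n * t)) = x ^ n" for n by (simp add: x_def exp_of_nat_mult[symmetric])
  let ?P = "\<lambda>N. {p. prime p \<and> p \<le> N} :: nat set"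
  have finP: "finite (?P N)" for N by (rule finite_subset[of _ "{..N}"]) auto
  have prod: "(\<Prod>p\<in>?P N. 1 / (1 - x ^ p)) = exp (\<Sum>n<Suc N. if prime n then neg_log_kernel (real n * t) else 0)" for N
  proof -
    have "(\<Sum>n<Suc N. if prime n then neg_log_kernel (real n * t) else 0) = (\<Sum>p\<in>?P N. neg_log_kernel (real p * t))"
      by (rule sum.mono_neutral_cong_right) (auto simp: less_Suc_eq_le)
    moreover have "exp (neg_log_kernel (real p * t)) = 1 / (1 - x ^ p)" if "p \<in> ?P N" for p
    proof -
      have "p > 0" using that prime_gt_0_nat by auto
      then have "x ^ p < 1" using x by (simp add: power_less_one_iff)
      then show ?thesis unfolding neg_log_kernel_def xn by (simp add: exp_minus inverse_eq_divide)
    qed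
    ultimately show ?thesis by (simp add: exp_sum[OF finP])
  qed
  have gf: "(\<lambda>n. real (card (partitions_into (?P N) n)) * x ^ n) sums exp (\<Sum>n<Suc N. if prime n then neg_log_kernel (real n * t) else 0)" for N
  proof -
    have "?P N \<subseteq> {p. prime p}" by auto
    from partitions_into_sums[OF finP this x] show ?thesis unfolding prod .
  qed
  have le: "exp (\<Sum>n<Suc N. if prime n then neg_log_kernel (real n * t) else 0) \<le> exp (prime_log t)" for N
    using sum_le_sums[OF prime_log_sums[OF t], of "{..<Suc N}"] neg_log_kernel_nat_nonneg[OF t] by simp
  have fin: "(\<Sum>n\<le>N. real (pp n) * x ^ n) \<le> exp (prime_log t)" for N
  proof -
    have "(\<Sum>n\<le>N. real (pp n) * x ^ n) = (\<Sum>n\<le>N. real (card (partitions_into (?P N) n)) * x ^ n)"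
      by (rule sum.cong) (auto simp: pp_def partitions_into_bounded)
    also have "\<dots> \<le> exp (\<Sum>n<Suc N. if prime n then neg_log_kernel (real n * t) else 0)"
      by (rule sum_le_sums[OF gf]) (use x in auto)
    finally show ?thesis using le[of N] by linarith
  qed
  have "summable (\<lambda>n. real (pp n) * x ^ n)"
    by (rule bounded_imp_summable[OF _ fin]) (use x in auto)
  then have S: "(\<lambda>n. real (pp n) * x ^ n) sums (\<Sum>n. real (pp n) * x ^ n)" by (rule summable_sums)
  have "(\<Sum>n. real (pp n) * x ^ n) \<le> exp (prime_log t)"
    using S fin unfolding sums_def_le by (intro LIMSEQ_le_const2) auto
  moreover have "exp (prime_log t) \<le> (\<Sum>n. real (pp n) * x ^ n)"
  proof (rule LIMSEQ_le_const2)
    show "(\<lambda>N. exp (\<Sum>n<Suc N. if prime n then neg_log_kernel (real n * t) else 0)) \<longlonglongrightarrow> exp (prime_log t)"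
      using prime_log_sums[OF t] unfolding sums_def by (intro tendsto_exp LIMSEQ_Suc)
    have "exp (\<Sum>n<Suc N. if prime n then neg_log_kernel (real n * t) else 0) \<le> (\<Sum>n. real (pp n) * x ^ n)" for N
    proof (rule sums_le[OF _ gf S])
      fix n
      have "card (partitions_into (?P N) n) \<le> pp n"
        unfolding pp_def by (intro card_mono finite_prime_partitions partitions_into_subset) auto
      then show "real (card (partitions_into (?P N) n)) * x ^ n \<le> real (pp n) * x ^ n"
        using x by (intro mult_right_mono) auto
    qed
    then show "\<exists>N. \<forall>n\<ge>N. exp (\<Sum>n<Suc n. if prime n then neg_log_kernel (real n * t) else 0) \<le> (\<Sum>n. real (pp n) * x ^ n)"
      by blast
  qed
  ultimately show ?thesis using S by (simp add: xn)
qed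

section \<open>Bounds for pp from its generating function\<close>

lemma sum_list_insort: "sum_list (insort x xs) = x + sum_list (xs :: nat list)"
  by (induction xs) auto

lemma pp_le_pp_add_prime:
  assumes "prime p"
  shows "pp n \<le> pp (n + p)"
  unfolding pp_def
proof (rule card_inj_on_le)
  show "inj_on (insort p) (prime_partitions n)"
    by (rule inj_on_inverseI[where g = "remove1 p"]) simp
  show "insort p ` prime_partitions n \<subseteq> prime_partitions (n + p)"
    using assms by (auto simp: prime_partitions_def sum_list_insort sorted_insort set_insort_key)
qed (rule finite_prime_partitions)

text \<open>The gap of 2 cannot be lowered to 1: \<open>pp 0 = 1\<close> but
  \<open>pp 1 = 0\<close>. Gaps 2 and 3 start the induction, and each further part 2 extends
  it.\<close>

lemma pp_quasi_mono:
  assumes "m + 2 \<le> n"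
  shows "pp m \<le> pp n"
proof -
  have "pp m \<le> pp (m + 2 + k)" for k
  proof (induction k rule: less_induct)
    case (less k)
    have 2: "prime (2::nat)" and 3: "prime (3::nat)" by simp_all
    consider "k = 0" | "k = 1" | j where "k = j + 2" by (metis One_nat_def add_2_eq_Suc' not0_implies_Suc)
    then show ?case
    proof cases
      case 1
      then show ?thesis using pp_le_pp_add_prime[OF 2, of m] by simp
    next
      case k: 2
      then show ?thesis using pp_le_pp_add_prime[OF 3, of m] by (simp add: numeral_3_eq_3)
    next
      case k: 3
      have "pp m \<le> pp (m + 2 + j)" using less[of j] k by simp
      also have "\<dots> \<le> pp (m + 2 + j + 2)" by (rule pp_le_pp_add_prime[OF 2])
      finally show ?thesis using k by (simp add: add.assoc)
    qed
  qed
  from this[of "n - (m + 2)"] show ?thesis unfolding le_add_diff_inverse[OF assms] .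
qed

lemma ln_pp_le:
  assumes t: "t > 0" and n: "pp n > 0"
  shows "ln (real (pp n)) \<le> real n * t + prime_log t"
proof -
  have "real (pp n) * exp (- (real n * t)) \<le> exp (prime_log t)"
    using sum_le_sums[OF pp_sums[OF t], of "{n}"] by simp
  then have "ln (real (pp n) * exp (- (real n * t))) \<le> ln (exp (prime_log t))"
    by (rule ln_mono) (use n in simp)
  then show ?thesis using n by (simp add: ln_mult)
qed

text \<open>Comparing with the generating function at \<open>s\<close> bounds the terms \<open>m \<le> r\<close>, and at \<open>u\<close> those with
  \<open>m \<ge> n - 1\<close>; the remaining ones are at most \<open>pp n * exp (- r * t)\<close> by quasi-monotonicity.\<close>
lemma exp_prime_log_le:
  assumes u: "0 < u" "u \<le> t" and s: "t \<le> s"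
  shows "exp (prime_log t) \<le> exp (prime_log s + r * (s - t)) + real n * real (pp n) * exp (- (r * t))
    + exp (prime_log u - (real n - 1) * (t - u))"
proof -
  let ?g = "\<lambda>m. if m \<in> {..<n} then real (pp n) * exp (- (r * t)) else 0"
  have g: "?g sums (\<Sum>m\<in>{..<n}. real (pp n) * exp (- (r * t)))"
    by (rule sums_If_finite_set) simp
  have 1: "(\<lambda>m. exp (r * (s - t)) * (real (pp m) * exp (- (real m * s)))) sums (exp (r * (s - t)) * exp (prime_log s))"
    by (intro sums_mult pp_sums) (use u s in simp)
  have 2: "(\<lambda>m. exp (- ((real n - 1) * (t - u))) * (real (pp m) * exp (- (real m * u)))) sums (exp (- ((real n - 1) * (t - u))) * exp (prime_log u))"
    by (intro sums_mult pp_sums) (use u in simp)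
  have t: "t > 0" using u by simp
  have "exp (prime_log t) \<le> exp (r * (s - t)) * exp (prime_log s) + (\<Sum>m\<in>{..<n}. real (pp n) * exp (- (r * t)))
      + exp (- ((real n - 1) * (t - u))) * exp (prime_log u)"
  proof (rule sums_le[OF _ pp_sums[OF t] sums_add[OF sums_add[OF 1 g] 2]])
    fix m
    let ?T = "real (pp m) * exp (- (real m * t))"
    have p1: "exp (r * (s - t)) * (real (pp m) * exp (- (real m * s))) \<ge> 0" by simp
    have p2: "exp (- ((real n - 1) * (t - u))) * (real (pp m) * exp (- (real m * u))) \<ge> 0" by simp
    have p3: "?g m \<ge> 0" by simp
    \<comment> \<open>The last range starts at m = n - 1, the one index below n about which
      \<open>pp_quasi_mono\<close> is silent; hence \<open>real n - 1\<close> in the bound.\<close>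
    consider "real m \<le> r" | "m + 2 \<le> n" "real m > r" | "n < m + 2" by linarith
    then show "?T \<le> exp (r * (s - t)) * (real (pp m) * exp (- (real m * s))) + ?g m
       + exp (- ((real n - 1) * (t - u))) * (real (pp m) * exp (- (real m * u)))"
    proof cases
      case 1
      have "real m * (s - t) \<le> r * (s - t)" using 1 s by (intro mult_right_mono) auto
      then have "exp (- (real m * t)) \<le> exp (r * (s - t) + - (real m * s))" by (simp add: algebra_simps)
      then have "?T \<le> real (pp m) * exp (r * (s - t) + - (real m * s))" by (intro mult_left_mono) auto
      also have "\<dots> = exp (r * (s - t)) * (real (pp m) * exp (- (real m * s)))" by (simp only: exp_add mult_ac)
      finally show ?thesis using p2 p3 by linarith
    next
      case 2
      have "real (pp m) \<le> real (pp n)" using pp_quasi_mono[OF 2(1)] by simp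
      moreover have "r * t \<le> real m * t" using 2 t by (intro mult_right_mono) auto
      ultimately have "?T \<le> real (pp n) * exp (- (r * t))" by (intro mult_mono) auto
      also have "\<dots> = ?g m" using 2 by simp
      finally show ?thesis using p1 p2 by linarith
    next
      case 3
      then have "(real n - 1) * (t - u) \<le> real m * (t - u)" using u by (intro mult_right_mono) auto
      then have "exp (- (real m * t)) \<le> exp (- ((real n - 1) * (t - u)) + - (real m * u))" by (simp add: algebra_simps)
      then have "?T \<le> real (pp m) * exp (- ((real n - 1) * (t - u)) + - (real m * u))" by (intro mult_left_mono) auto
      also have "\<dots> = exp (- ((real n - 1) * (t - u))) * (real (pp m) * exp (- (real m * u)))" by (simp only: exp_add mult_ac)
      finally show ?thesis using p1 p3 by linarith
    qed
  qed
  also have "(\<Sum>m\<in>{..<n}. real (pp n) * exp (- (r * t))) = real n * real (pp n) * exp (- (r * t))" by simp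
  finally show ?thesis unfolding exp_add exp_diff by (simp add: exp_minus divide_inverse mult.commute)
qed

section \<open>Evaluation near the saddle point\<close>

definition saddle :: "nat \<Rightarrow> real" where
  "saddle n = pi / sqrt (3 * real n * ln (real n))"

text \<open>With ln (1 / t) close to (ln n) / 2, F(t) is about pi^2 / (3 t ln n). Equating this with
  n t gives \<open>saddle n\<close>, and \<open>main_term n\<close> is the resulting size of each
  summand, half of the claimed asymptotics.\<close>

definition main_term :: "nat \<Rightarrow> real" where
  "main_term n = real n * saddle n"

lemma main_term_eq:
  assumes "n \<ge> 2"
  shows "main_term n = pi * sqrt (real n / (3 * ln (real n)))"
proof -
  have l: "ln (real n) > 0" using assms by simp
  have "real n / sqrt (3 * real n * ln (real n)) = sqrt (real n / (3 * ln (real n)))"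
    using l assms by (simp add: real_sqrt_mult real_sqrt_divide field_simps)
  then show ?thesis unfolding main_term_def saddle_def
    by (metis mult.commute times_divide_eq_right)
qed

text \<open>The second limit converts \<open>prime_log_asymptotic\<close> into units of
  \<open>main_term\<close>; the logarithm contributes (ln n) / 2, which turns the 1 / 3 inside
  \<open>saddle\<close> into 1 / 6.\<close>

lemma saddle_limits:
  assumes a: "a > 0"
  shows "filterlim (\<lambda>n. a * saddle n) (at_right 0) sequentially"
    and "(\<lambda>n. main_term n * (a * saddle n * ln (1 / (a * saddle n)))) \<longlonglongrightarrow> a * (pi\<^sup>2 / 6)"
proof -
  show "filterlim (\<lambda>n. a * saddle n) (at_right 0) sequentially"
    unfolding saddle_def using a by real_asymp
  show "(\<lambda>n. main_term n * (a * saddle n * ln (1 / (a * saddle n)))) \<longlonglongrightarrow> a * (pi\<^sup>2 / 6)"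
    unfolding main_term_def saddle_def using a
    by real_asymp (simp add: powr_half_sqrt field_simps power2_eq_square)
qed

lemma prime_log_saddle:
  assumes a: "a > 0"
  shows "(\<lambda>n. prime_log (a * saddle n) / main_term n) \<longlonglongrightarrow> 1 / a"
proof -
  let ?q = "\<lambda>n. a * saddle n * ln (1 / (a * saddle n))"
  have "(\<lambda>n. (?q n * prime_log (a * saddle n)) / (main_term n * ?q n)) \<longlonglongrightarrow> (pi\<^sup>2 / 6) / (a * (pi\<^sup>2 / 6))"
    using filterlim_compose[OF prime_log_asymptotic saddle_limits(1)[OF a]] a
    by (intro tendsto_divide saddle_limits(2)) auto
  moreover have "\<forall>\<^sub>F n in sequentially. ?q n > 0"
    unfolding saddle_def using a by real_asymp
  then have "\<forall>\<^sub>F n in sequentially. (?q n * prime_log (a * saddle n)) / (main_term n * ?q n) = prime_log (a * saddle n) / main_term n"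
  proof eventually_elim
    case (elim n)
    then have "?q n \<noteq> 0" by linarith
    from nonzero_mult_divide_mult_cancel_left[OF this, of "prime_log (a * saddle n)" "main_term n"]
    show ?case by (simp only: mult.commute[of "main_term n"])
  qed
  ultimately have "(\<lambda>n. prime_log (a * saddle n) / main_term n) \<longlonglongrightarrow> (pi\<^sup>2 / 6) / (a * (pi\<^sup>2 / 6))"
    by (rule Lim_transform_eventually)
  then show ?thesis by simp
qed

text \<open>With F(a * saddle) about K / a, where K is \<open>main_term n\<close>, the series at a *
  saddle should concentrate near index n / a^2. The choice a = 1 + d puts this between (1 - 4 d) n
  and n - 1, so the middle range of \<open>exp_prime_log_le\<close> carries the sum; the outer
  ranges are tested at a = 1 + 2 d and a = 1.\<close>

lemma ln_pp_lower:
  assumes d: "0 < d" "d < 1 / 4"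
  shows "\<forall>\<^sub>F n in sequentially. ln (real (pp n)) / main_term n > 2 - 8 * d"
proof -
  let ?F = "\<lambda>a n. prime_log (a * saddle n)" and ?K = main_term
  let ?a = "1 + d" and ?b = "1 + 2 * d" and ?c = "1 - 4 * d"
  note F = prime_log_saddle
  \<comment> \<open>The \<open>ln 4\<close> makes each outer term at most a quarter of the total,
    leaving half for the middle. It is negligible because \<open>main_term\<close> tends to
    infinity.\<close>
  have c0: "(\<lambda>n. ln 4 / ?K n) \<longlonglongrightarrow> 0" unfolding main_term_def saddle_def by real_asymp
  have c1: "(\<lambda>n. ln (2 * real n) / ?K n) \<longlonglongrightarrow> 0" unfolding main_term_def saddle_def by real_asymp
  have c2: "(\<lambda>n. (real n - 1) * (d * saddle n) / ?K n) \<longlonglongrightarrow> d" unfolding main_term_def saddle_def using d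
    by real_asymp (simp add: field_simps)
  have "(\<lambda>n. ?F ?a n / ?K n - ?F 1 n / ?K n + (real n - 1) * (d * saddle n) / ?K n - ln 4 / ?K n)
     \<longlonglongrightarrow> 1 / ?a - 1 / 1 + d - 0"
    by (intro tendsto_add tendsto_diff F c0 c2) (use d in auto)
  moreover have "0 < 1 / ?a - 1 / 1 + d - 0" using d by (simp add: field_simps)
  ultimately have e1: "\<forall>\<^sub>F n in sequentially. 0 < ?F ?a n / ?K n - ?F 1 n / ?K n + (real n - 1) * (d * saddle n) / ?K n - ln 4 / ?K n"
    by (rule order_tendstoD)
  \<comment> \<open>Indices up to (1 - 4 d) n: their exponent, 1 / (1 + 2 d) + (1 - 4 d) d in units
    of \<open>main_term\<close>, must fall below 1 / (1 + d). This reduces to (1 - 4 d) (1 + d) (1 +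
    2 d) < 1.\<close>
  have "(\<lambda>n. ?F ?a n / ?K n - ?F ?b n / ?K n - ?c * d - ln 4 / ?K n) \<longlonglongrightarrow> 1 / ?a - 1 / ?b - ?c * d - 0"
    by (intro tendsto_diff tendsto_const F c0) (use d in auto)
  moreover have "0 < 1 / ?a - 1 / ?b - ?c * d - 0"
  proof -
    have "1 / ?a - 1 / ?b = d / (?a * ?b)" using d by (simp add: field_simps)
    moreover have "?c * (?a * ?b) < 1"
    proof -
      have "?c * (?a * ?b) = 1 - d - 10 * d\<^sup>2 - 8 * d ^ 3" by (simp add: algebra_simps power2_eq_square power3_eq_cube)
      then show ?thesis using d by (smt (verit) zero_le_power zero_less_power)
    qed
    then have "?c < 1 / (?a * ?b)" using d by (simp add: pos_less_divide_eq)
    then have "d * ?c < d * (1 / (?a * ?b))" using d by (intro mult_strict_left_mono) auto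
    ultimately show ?thesis by (simp add: mult.commute)
  qed
  ultimately have e2: "\<forall>\<^sub>F n in sequentially. 0 < ?F ?a n / ?K n - ?F ?b n / ?K n - ?c * d - ln 4 / ?K n"
    by (rule order_tendstoD)
  \<comment> \<open>What the middle range yields for \<open>ln (pp n)\<close>: the exponent of the
    total plus r t in units of \<open>main_term\<close>, where the factor n and the loss of one half
    cost only \<open>ln (2 * n)\<close>.\<close>
  have "(\<lambda>n. ?F ?a n / ?K n + ?c * ?a - ln (2 * real n) / ?K n) \<longlonglongrightarrow> 1 / ?a + ?c * ?a - 0"
    by (intro tendsto_diff tendsto_add tendsto_const F c1) (use d in auto)
  moreover have "2 - 8 * d < 1 / ?a + ?c * ?a - 0"
  proof -
    have "1 - d < 1 / ?a" using d by (simp add: field_simps)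
    moreover have "?c * ?a = 1 - 3 * d - 4 * d * d" by (simp add: algebra_simps)
    moreover have "4 * d * d < 4 * d * (1 / 4)" using d by (intro mult_strict_left_mono) auto
    ultimately show ?thesis using d(1) by linarith
  qed
  ultimately have e3: "\<forall>\<^sub>F n in sequentially. 2 - 8 * d < ?F ?a n / ?K n + ?c * ?a - ln (2 * real n) / ?K n"
    by (rule order_tendstoD)
  have s: "\<forall>\<^sub>F n in sequentially. saddle n > 0" unfolding saddle_def by real_asymp
  show ?thesis
    using e1 e2 e3 s eventually_gt_at_top[of 0]
  proof eventually_elim
    case (elim n)
    define u where "u = saddle n"
    define K where "K = ?K n"
    have u: "u > 0" using elim by (simp add: u_def)
    have K: "K = real n * u" by (simp add: K_def main_term_def u_def)
    have K0: "K > 0" using elim u K by simp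
    let ?t = "?a * u"
    define P where "P = real n * real (pp n) * exp (- (?c * real n * ?t))"
    have ht: "?F 1 n = prime_log u" "?F ?a n = prime_log ?t" "?F ?b n = prime_log (?b * u)" by (simp_all add: u_def)
    have "0 < K * (?F ?a n / K - ?F 1 n / K + (real n - 1) * (d * u) / K - ln 4 / K)"
      using elim(1) K0 by (simp add: K_def u_def)
    also have "\<dots> = prime_log ?t - prime_log u + (real n - 1) * (d * u) - ln 4"
      unfolding ht using K0 by (simp add: right_diff_distrib distrib_left)
    finally have 1: "prime_log u - (real n - 1) * (?t - u) \<le> prime_log ?t - ln 4" by (simp add: algebra_simps)
    have "0 < K * (?F ?a n / K - ?F ?b n / K - ?c * d - ln 4 / K)"
      using elim(2) K0 by (simp add: K_def)
    also have "\<dots> = prime_log ?t - prime_log (?b * u) - ?c * d * K - ln 4"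
      unfolding ht using K0 by (simp add: right_diff_distrib)
    finally have "prime_log (?b * u) + ?c * d * K \<le> prime_log ?t - ln 4" by simp
    moreover have "?c * real n * (?b * u - ?t) = ?c * d * K" unfolding K by (simp add: algebra_simps)
    ultimately have 2: "prime_log (?b * u) + ?c * real n * (?b * u - ?t) \<le> prime_log ?t - ln 4" by (simp only:)
    have q: "exp (prime_log ?t - ln 4) = exp (prime_log ?t) / 4" by (simp add: exp_diff)
    have "exp (prime_log ?t) \<le> exp (prime_log (?b * u) + ?c * real n * (?b * u - ?t)) + P
        + exp (prime_log u - (real n - 1) * (?t - u))"
      unfolding P_def by (rule exp_prime_log_le) (use d u in auto)
    also have "\<dots> \<le> exp (prime_log ?t) / 4 + P + exp (prime_log ?t) / 4"
      using 1 2 unfolding q[symmetric] by (intro add_mono) auto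
    finally have P: "exp (prime_log ?t) / 2 \<le> P" by simp
    have pp0: "pp n > 0"
    proof (rule ccontr)
      assume "\<not> pp n > 0"
      then have "P = 0" by (simp add: P_def)
      then show False using P exp_gt_zero[of "prime_log ?t"] by linarith
    qed
    have "prime_log ?t - ln 2 = ln (exp (prime_log ?t) / 2)" by (simp add: ln_div)
    also have "\<dots> \<le> ln P" using P by (intro ln_mono) (auto intro: less_le_trans[OF _ P])
    also have "\<dots> = ln (real n) + ln (real (pp n)) - ?c * real n * ?t"
      unfolding P_def using pp0 elim by (simp add: ln_mult)
    finally have "prime_log ?t + ?c * ?a * K - ln (2 * real n) \<le> ln (real (pp n))"
      using elim unfolding K by (simp add: ln_mult mult_ac)
    then have "(prime_log ?t + ?c * ?a * K - ln (2 * real n)) / K \<le> ln (real (pp n)) / K"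
      using K0 by (intro divide_right_mono) auto
    moreover have "(prime_log ?t + ?c * ?a * K - ln (2 * real n)) / K = ?F ?a n / K + ?c * ?a - ln (2 * real n) / K"
      unfolding ht using K0 by (simp add: diff_divide_distrib add_divide_distrib)
    ultimately show ?case using elim(3) unfolding K_def by linarith
  qed
qed

lemma ln_pp_asymptotic: "(\<lambda>n. ln (real (pp n)) / main_term n) \<longlonglongrightarrow> 2"
proof (rule order_tendstoI)
  fix a :: real assume a: "2 < a"
  have "(\<lambda>n. 1 + prime_log (1 * saddle n) / main_term n) \<longlonglongrightarrow> 1 + 1 / 1"
    by (intro tendsto_add tendsto_const prime_log_saddle) simp
  then have "\<forall>\<^sub>F n in sequentially. 1 + prime_log (1 * saddle n) / main_term n < a"
    using a by (intro order_tendstoD) auto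
  moreover have "\<forall>\<^sub>F n in sequentially. saddle n > 0" unfolding saddle_def by real_asymp
  ultimately show "\<forall>\<^sub>F n in sequentially. ln (real (pp n)) / main_term n < a"
    using eventually_gt_at_top[of 0]
  proof eventually_elim
    case (elim n)
    have K: "main_term n > 0" using elim by (simp add: main_term_def)
    show ?case
    proof (cases "pp n > 0")
      case True
      have "ln (real (pp n)) \<le> main_term n + prime_log (saddle n)"
        using ln_pp_le[OF elim(2) True] by (simp add: main_term_def)
      then have "ln (real (pp n)) / main_term n \<le> (main_term n + prime_log (saddle n)) / main_term n"
        using K by (intro divide_right_mono) auto
      also have "\<dots> = 1 + prime_log (1 * saddle n) / main_term n" using K by (simp add: add_divide_distrib)
      finally show ?thesis using elim(1) by linarith
    \<comment> \<open>If \<open>pp n = 0\<close>, the convention \<open>ln 0 = 0\<close> makes the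
      quotient 0, which is below \<open>a\<close>.\<close>
    qed (use a in simp)
  qed
next
  fix a :: real assume a: "a < 2"
  define d where "d = min ((2 - a) / 8) (1 / 8)"
  have d: "0 < d" "d < 1 / 4" "a \<le> 2 - 8 * d"
  proof -
    have "d \<le> (2 - a) / 8" unfolding d_def by (rule min.cobounded1)
    then have "8 * d \<le> 8 * ((2 - a) / 8)" by (rule mult_left_mono) simp
    also have "\<dots> = 2 - a" by simp
    finally show "a \<le> 2 - 8 * d" by simp
  qed (use a in \<open>auto simp: d_def min_def\<close>)
  from ln_pp_lower[OF d(1,2)] show "\<forall>\<^sub>F n in sequentially. a < ln (real (pp n)) / main_term n"
    by eventually_elim (use d(3) in linarith)
qed

theorem theorem1p2:
  shows "(\<lambda>n::nat. ln (real (pp n))) \<sim>[sequentially]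
         (\<lambda>n. 2 * pi * sqrt (real n / (3 * ln (real n))))"
proof (rule asymp_equivI')
  have "(\<lambda>n. ln (real (pp n)) / main_term n / 2) \<longlonglongrightarrow> 2 / 2"
    by (intro tendsto_divide ln_pp_asymptotic tendsto_const) simp
  moreover have "\<forall>\<^sub>F n in sequentially. ln (real (pp n)) / main_term n / 2 = ln (real (pp n)) / (2 * pi * sqrt (real n / (3 * ln (real n))))"
    using eventually_ge_at_top[of 2] by eventually_elim (simp add: main_term_eq)
  ultimately show "(\<lambda>n. ln (real (pp n)) / (2 * pi * sqrt (real n / (3 * ln (real n))))) \<longlonglongrightarrow> 1"
    by (simp add: Lim_transform_eventually)
qed

end
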